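(* Let $q$ be a prime power and $n\ge 1$ an integer. Then there is an isomorphism of $\mathbb{F}_q$-algebras \[\mathscr{L}_n(\mathbb{F}_{q^n})\cong \mathbb{F}_{q^n}^\vee\otimes_{\mathbb{F}_q}\mathbb{F}_{q^n},\] where $\mathscr{L}_n(\mathbb{F}_{q^n})$ is the algebra of linearized polynomials and $\mathbb{F}_{q^n}^\vee\otimes_{\mathbb{F}_q}\mathbb{F}_{q^n}$ is the composition algebra on $\mathbb{F}_{q^n}$.
   Context: $\mathscr{L}_n(\mathbb{F}_{q^n})$ is the set of all linearized polynomials $L(x)=\sum_{i=0}^{n-1}a_ix^{q^i}\in\mathbb{F}_{q^n}[x]/(x^{q^n}-x)$ with $a_i\in\mathbb{F}_{q^n}$. It is an $\mathbb{F}_q$-algebra under addition, composition $\circ$ of polynomials (modulo $x^{q^n}-x$) as multiplication, and scalar multiplication by elements of $\mathbb{F}_q$. $\mathbb{F}_{q^n}^\vee=\mathrm{Hom}_{\mathbb{F}_q}(\mathbb{F}_{q^n},\mathbb{F}_q)$ is the dual space. The composition algebra $\mathbb{F}_{q^n}^\vee\otimes_{\mathbb{F}_q}\mathbb{F}_{q^n}$ is the tensor product vector space with the multiplication determined by $(l_1\otimes x_1)(l_2\otimes x_2)=l_1(x_2)\,l_2\otimes x_1$ for $l_1,l_2\in\mathbb{F}_{q^n}^\vee$, $x_1,x_2\in\mathbb{F}_{q^n}$, extended by linearity. *)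

theory Defs
  imports
    "HOL-Algebra.UnivPoly"
    "HOL-Algebra.QuotRing"
    "HOL-Algebra.Subrings"
    "HOL-Number_Theory.Prime_Powers"
begin

section \<open>Associative algebras and their isomorphisms\<close>

text \<open>The locale \<^locale>\<open>algebra\<close> only covers commutative algebras.\<close>

locale assoc_algebra = module R M + ring M for R (structure) and M (structure) +
  assumes smult_mult_left:
      "\<lbrakk> c \<in> carrier R; x \<in> carrier M; y \<in> carrier M \<rbrakk> \<Longrightarrow>
        (c \<odot>\<^bsub>M\<^esub> x) \<otimes>\<^bsub>M\<^esub> y = c \<odot>\<^bsub>M\<^esub> (x \<otimes>\<^bsub>M\<^esub> y)"
    and smult_mult_right:
      "\<lbrakk> c \<in> carrier R; x \<in> carrier M; y \<in> carrier M \<rbrakk> \<Longrightarrow>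
        x \<otimes>\<^bsub>M\<^esub> (c \<odot>\<^bsub>M\<^esub> y) = c \<odot>\<^bsub>M\<^esub> (x \<otimes>\<^bsub>M\<^esub> y)"

definition algebra_iso ::
    "('a, 'r) ring_scheme \<Rightarrow> ('a, 'b, 'm) module_scheme \<Rightarrow> ('a, 'c, 'n) module_scheme \<Rightarrow> ('b \<Rightarrow> 'c) set"
  where "algebra_iso R A B =
    {h \<in> ring_iso A B. \<forall>c\<in>carrier R. \<forall>a\<in>carrier A. h (c \<odot>\<^bsub>A\<^esub> a) = c \<odot>\<^bsub>B\<^esub> h a}"

text \<open>Scalar multiplication on cosets, in the style of \<^const>\<open>rcoset_mult\<close>.\<close>

definition coset_smult :: "('a, 'b, 'm) module_scheme \<Rightarrow> 'b set \<Rightarrow> 'a \<Rightarrow> 'b set \<Rightarrow> 'b set"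
  where "coset_smult M N c A = (\<Union>f\<in>A. N +>\<^bsub>M\<^esub> (c \<odot>\<^bsub>M\<^esub> f))"


section \<open>Linearized polynomials\<close>

text \<open>Substitution: \<open>up_compose K f g\<close> is the polynomial \<open>f(g(x))\<close>.\<close>

definition up_compose :: "('a, 'r) ring_scheme \<Rightarrow> (nat \<Rightarrow> 'a) \<Rightarrow> (nat \<Rightarrow> 'a) \<Rightarrow> (nat \<Rightarrow> 'a)"
  where "up_compose K f g = UnivPoly.eval K (UP K) (\<lambda>a. up_ring.monom (UP K) a 0) g f"

definition frobenius_ideal :: "('a, 'r) ring_scheme \<Rightarrow> nat \<Rightarrow> nat \<Rightarrow> (nat \<Rightarrow> 'a) set"
  where "frobenius_ideal K q n =
    PIdl\<^bsub>UP K\<^esub> (up_ring.monom (UP K) \<one>\<^bsub>K\<^esub> (q ^ n) \<ominus>\<^bsub>UP K\<^esub> up_ring.monom (UP K) \<one>\<^bsub>K\<^esub> 1)"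

text \<open>Elements are residue classes modulo \<open>x\<^bsup>q^n\<^esup> - x\<close>. The product of two classes is formed
  from all representatives, linearized or not, as in \<^const>\<open>rcoset_mult\<close>; it is a single class when
  the field has \<open>q\<^bsup>n\<^esup>\<close> elements.\<close>

definition linearized_algebra ::
    "('a, 'r) ring_scheme \<Rightarrow> nat \<Rightarrow> nat \<Rightarrow> ('a, (nat \<Rightarrow> 'a) set) module"
  where "linearized_algebra K q n =
    (let P = UP K; I = frobenius_ideal K q n in
     \<lparr>carrier = {I +>\<^bsub>P\<^esub> (\<Oplus>\<^bsub>P\<^esub>i\<in>{..<n}. up_ring.monom P (a i) (q ^ i)) | a. a \<in> {..<n} \<rightarrow> carrier K},
      monoid.mult = (\<lambda>A B. \<Union>f\<in>A. \<Union>g\<in>B. I +>\<^bsub>P\<^esub> up_compose K f g),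
      one = I +>\<^bsub>P\<^esub> up_ring.monom P \<one>\<^bsub>K\<^esub> 1,
      zero = I,
      add = set_add P,
      smult = coset_smult P I\<rparr>)"


section \<open>Dual modules and tensor products\<close>

text \<open>The records below that serve only as modules leave \<^const>\<open>monoid.mult\<close> and \<^const>\<open>one\<close>
  unspecified; neither \<^locale>\<open>module\<close> nor \<^locale>\<open>submodule\<close> refers to them.\<close>

definition dual_module ::
    "('a, 'r) ring_scheme \<Rightarrow> ('a, 'v, 'm) module_scheme \<Rightarrow> ('a, 'v \<Rightarrow> 'a) module"
  where "dual_module R V =
    \<lparr>carrier = {l \<in> carrier V \<rightarrow>\<^sub>E carrier R.
        (\<forall>x\<in>carrier V. \<forall>y\<in>carrier V. l (x \<oplus>\<^bsub>V\<^esub> y) = l x \<oplus>\<^bsub>R\<^esub> l y) \<and>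
        (\<forall>c\<in>carrier R. \<forall>x\<in>carrier V. l (c \<odot>\<^bsub>V\<^esub> x) = c \<otimes>\<^bsub>R\<^esub> l x)},
     monoid.mult = undefined,
     one = undefined,
     zero = (\<lambda>x\<in>carrier V. \<zero>\<^bsub>R\<^esub>),
     add = (\<lambda>l m. \<lambda>x\<in>carrier V. l x \<oplus>\<^bsub>R\<^esub> m x),
     smult = (\<lambda>c l. \<lambda>x\<in>carrier V. c \<otimes>\<^bsub>R\<^esub> l x)\<rparr>"

definition free_module :: "('a, 'r) ring_scheme \<Rightarrow> 's set \<Rightarrow> ('a, 's \<Rightarrow> 'a) module"
  where "free_module R S =
    \<lparr>carrier = {f \<in> S \<rightarrow>\<^sub>E carrier R. finite {s \<in> S. f s \<noteq> \<zero>\<^bsub>R\<^esub>}},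
     monoid.mult = undefined,
     one = undefined,
     zero = (\<lambda>s\<in>S. \<zero>\<^bsub>R\<^esub>),
     add = (\<lambda>f g. \<lambda>s\<in>S. f s \<oplus>\<^bsub>R\<^esub> g s),
     smult = (\<lambda>c f. \<lambda>s\<in>S. c \<otimes>\<^bsub>R\<^esub> f s)\<rparr>"

definition free_gen :: "('a, 'r) ring_scheme \<Rightarrow> 's set \<Rightarrow> 's \<Rightarrow> ('s \<Rightarrow> 'a)"
  where "free_gen R S t = (\<lambda>s\<in>S. if s = t then \<one>\<^bsub>R\<^esub> else \<zero>\<^bsub>R\<^esub>)"

abbreviation tensor_free ::
    "('a, 'r) ring_scheme \<Rightarrow> ('a, 'v, 'm) module_scheme \<Rightarrow> ('a, 'w, 'n) module_scheme \<Rightarrow>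
      ('a, 'v \<times> 'w \<Rightarrow> 'a) module"
  where "tensor_free R V W \<equiv> free_module R (carrier V \<times> carrier W)"

definition tensor_gen ::
    "('a, 'r) ring_scheme \<Rightarrow> ('a, 'v, 'm) module_scheme \<Rightarrow> ('a, 'w, 'n) module_scheme \<Rightarrow>
      'v \<Rightarrow> 'w \<Rightarrow> ('v \<times> 'w \<Rightarrow> 'a)"
  where "tensor_gen R V W v w = free_gen R (carrier V \<times> carrier W) (v, w)"

definition tensor_relations ::
    "('a, 'r) ring_scheme \<Rightarrow> ('a, 'v, 'm) module_scheme \<Rightarrow> ('a, 'w, 'n) module_scheme \<Rightarrow>
      ('v \<times> 'w \<Rightarrow> 'a) set"
  where "tensor_relations R V W =
    (let T = tensor_free R V W; g = tensor_gen R V W in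
       {g (v \<oplus>\<^bsub>V\<^esub> v') w \<ominus>\<^bsub>T\<^esub> (g v w \<oplus>\<^bsub>T\<^esub> g v' w) | v v' w.
          v \<in> carrier V \<and> v' \<in> carrier V \<and> w \<in> carrier W} \<union>
       {g v (w \<oplus>\<^bsub>W\<^esub> w') \<ominus>\<^bsub>T\<^esub> (g v w \<oplus>\<^bsub>T\<^esub> g v w') | v w w'.
          v \<in> carrier V \<and> w \<in> carrier W \<and> w' \<in> carrier W} \<union>
       {g (c \<odot>\<^bsub>V\<^esub> v) w \<ominus>\<^bsub>T\<^esub> (c \<odot>\<^bsub>T\<^esub> g v w) | c v w.
          c \<in> carrier R \<and> v \<in> carrier V \<and> w \<in> carrier W} \<union>
       {g v (c \<odot>\<^bsub>W\<^esub> w) \<ominus>\<^bsub>T\<^esub> (c \<odot>\<^bsub>T\<^esub> g v w) | c v w.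
          c \<in> carrier R \<and> v \<in> carrier V \<and> w \<in> carrier W})"

definition tensor_kernel ::
    "('a, 'r) ring_scheme \<Rightarrow> ('a, 'v, 'm) module_scheme \<Rightarrow> ('a, 'w, 'n) module_scheme \<Rightarrow>
      ('v \<times> 'w \<Rightarrow> 'a) set"
  where "tensor_kernel R V W =
    \<Inter> {N. submodule N R (tensor_free R V W) \<and> tensor_relations R V W \<subseteq> N}"

definition tensor_module ::
    "('a, 'r) ring_scheme \<Rightarrow> ('a, 'v, 'm) module_scheme \<Rightarrow> ('a, 'w, 'n) module_scheme \<Rightarrow>
      ('a, ('v \<times> 'w \<Rightarrow> 'a) set) module"
  where "tensor_module R V W =
    (let T = tensor_free R V W; N = tensor_kernel R V W in
     \<lparr>carrier = a_rcosets\<^bsub>T\<^esub> N,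
      monoid.mult = undefined,
      one = undefined,
      zero = N,
      add = set_add T,
      smult = coset_smult T N\<rparr>)"


section \<open>The composition algebra\<close>

text \<open>The bilinear extension of \<open>(l\<^sub>1, x\<^sub>1) \<cdot> (l\<^sub>2, x\<^sub>2) = l\<^sub>1(x\<^sub>2) (l\<^sub>2, x\<^sub>1)\<close>
  to the free module on pairs (functional, vector).\<close>

definition composition_free_mult ::
    "('a, 'r) ring_scheme \<Rightarrow> ('a, 'v, 'm) module_scheme \<Rightarrow>
      (('v \<Rightarrow> 'a) \<times> 'v \<Rightarrow> 'a) \<Rightarrow> (('v \<Rightarrow> 'a) \<times> 'v \<Rightarrow> 'a) \<Rightarrow> (('v \<Rightarrow> 'a) \<times> 'v \<Rightarrow> 'a)"
  where "composition_free_mult R V f g =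
    (let D = dual_module R V; S = carrier D \<times> carrier V; T = tensor_free R D V in
     finsum T
       (\<lambda>((l\<^sub>1, x\<^sub>1), (l\<^sub>2, x\<^sub>2)).
          (f (l\<^sub>1, x\<^sub>1) \<otimes>\<^bsub>R\<^esub> g (l\<^sub>2, x\<^sub>2) \<otimes>\<^bsub>R\<^esub> l\<^sub>1 x\<^sub>2) \<odot>\<^bsub>T\<^esub> tensor_gen R D V l\<^sub>2 x\<^sub>1)
       ({s \<in> S. f s \<noteq> \<zero>\<^bsub>R\<^esub>} \<times> {s \<in> S. g s \<noteq> \<zero>\<^bsub>R\<^esub>}))"

definition composition_mult ::
    "('a, 'r) ring_scheme \<Rightarrow> ('a, 'v, 'm) module_scheme \<Rightarrow>
      (('v \<Rightarrow> 'a) \<times> 'v \<Rightarrow> 'a) set \<Rightarrow> (('v \<Rightarrow> 'a) \<times> 'v \<Rightarrow> 'a) set \<Rightarrow> (('v \<Rightarrow> 'a) \<times> 'v \<Rightarrow> 'a) set"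
  where "composition_mult R V A B =
    (\<Union>f\<in>A. \<Union>g\<in>B.
       tensor_kernel R (dual_module R V) V +>\<^bsub>tensor_free R (dual_module R V) V\<^esub>
         composition_free_mult R V f g)"

text \<open>The unit is the two-sided identity, which exists when \<open>V\<close> is free of finite rank.\<close>

definition composition_algebra ::
    "('a, 'r) ring_scheme \<Rightarrow> ('a, 'v, 'm) module_scheme \<Rightarrow>
      ('a, (('v \<Rightarrow> 'a) \<times> 'v \<Rightarrow> 'a) set) module"
  where "composition_algebra R V =
    (let T = tensor_module R (dual_module R V) V in
     T\<lparr>monoid.mult := composition_mult R V,
       one := (THE e. e \<in> carrier T \<and>
         (\<forall>a\<in>carrier T. composition_mult R V e a = a \<and> composition_mult R V a e = a))\<rparr>)"

text \<open>A ring as a left module over itself, and hence over each of its subrings.\<close>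

definition ring_as_module :: "('a, 'r) ring_scheme \<Rightarrow> ('a, 'a) module"
  where "ring_as_module K =
    \<lparr>carrier = carrier K, monoid.mult = monoid.mult K, one = one K, zero = zero K,
     add = add K, smult = monoid.mult K\<rparr>"

end

theory Submission
  imports Defs "HOL-Algebra.Multiplicative_Group"
begin

text \<open>
  Both algebras are copies of the algebra \<open>End\<^sub>F(K)\<close> of \<open>F\<close>-linear maps \<open>K \<rightarrow> K\<close>, and the
  isomorphism of the theorem is the composite of the two identifications: a class of linearized
  polynomials acts on \<open>K\<close> by evaluation, and \<open>l \<otimes> x\<close> acts as the rank one map \<open>y \<mapsto> l(y) x\<close>.

  Each algebra is a quotient: its elements are cosets of a subgroup \<open>N\<close> in a group \<open>P\<close> of
  representatives (polynomials, or formal combinations of pairs), and its operations are defined on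
  cosets through all of their representatives. If an additive map \<open>\<Phi>\<close> from \<open>P\<close> to an algebra \<open>E\<close>
  respects the operations on representatives and has kernel \<open>N\<close>, then the cosets are the fibres of
  \<open>\<Phi>\<close>, and the quotient is isomorphic to \<open>E\<close>. The locale \<open>algebra_presentation\<close> carries out this
  argument once. Two kernels and two images remain to be determined.

  For the tensor product, let \<open>b\<^sub>i\<close> and \<open>c\<^sub>i\<close> be a basis of \<open>K\<close> over \<open>F\<close> and its coordinate functionals.
  A linear map \<open>\<phi>\<close> is the image of \<open>\<Sum>\<^sub>i (c\<^sub>i \<circ> \<phi>) \<otimes> b\<^sub>i\<close>, so the realization by linear maps is onto.
  Moreover \<open>l \<otimes> x = \<Sum>\<^sub>i c\<^sub>i(x) l \<otimes> b\<^sub>i\<close> follows from the relations of the tensor product alone, so every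
  tensor can be recovered from the linear map it realizes, and the realization is injective on the
  tensor product (\<open>lift_realize_cong\<close>, \<open>tensor_kernel_eq\<close>). The argument rests on the expansion
  \<open>x = \<Sum>\<^sub>i c\<^sub>i(x) b\<^sub>i\<close> and is carried out for any module with such a dual basis.

  For polynomials, those that vanish on \<open>K\<close> are exactly the multiples of \<open>x\<^bsup>q^n\<^esup> - x\<close>: the remainder of
  such a polynomial has fewer than \<open>q\<^sup>n\<close> coefficients and \<open>q\<^sup>n\<close> roots (\<open>frobenius_ideal_eq\<close>). Linearized
  polynomials act \<open>F\<close>-linearly because \<open>x \<mapsto> x\<^sup>q\<close> is additive and fixes \<open>F\<close>, and distinct
  coefficient families give distinct maps, again by counting roots. As there are \<open>(q\<^sup>n)\<^sup>n\<close> coefficient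
  families and at most as many linear maps, every linear map arises (\<open>linearized_surj\<close>).
\<close>

section \<open>Transport of structure and presentations of algebras\<close>

lemma algebra_iso_comp_inv:
  assumes "assoc_algebra R E" and "h \<in> algebra_iso R E A" and "k \<in> algebra_iso R E B"
  shows "k \<circ> inv_into (carrier E) h \<in> algebra_iso R A B"
proof -
  interpret E: assoc_algebra R E by fact
  have h: "h \<in> ring_iso E A" and k: "k \<in> ring_iso E B"
    using assms by (auto simp: algebra_iso_def)
  let ?g = "inv_into (carrier E) h"
  have g: "?g \<in> ring_iso A E"
    using ring_iso_set_sym[OF E.ring_axioms h] .
  have bij: "bij_betw h (carrier E) (carrier A)"
    using h by (simp add: ring_iso_def)
  have gs: "?g (c \<odot>\<^bsub>A\<^esub> a) = c \<odot>\<^bsub>E\<^esub> ?g a" and ga: "?g a \<in> carrier E"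
    if c: "c \<in> carrier R" and a: "a \<in> carrier A" for c a
  proof -
    show e: "?g a \<in> carrier E"
      using bij a bij_betw_imp_surj_on inv_into_into by metis
    have "h (c \<odot>\<^bsub>E\<^esub> ?g a) = c \<odot>\<^bsub>A\<^esub> a"
      using assms(2) c e bij a by (simp add: algebra_iso_def bij_betw_inv_into_right)
    then show "?g (c \<odot>\<^bsub>A\<^esub> a) = c \<odot>\<^bsub>E\<^esub> ?g a"
      using bij c e by (metis E.smult_closed bij_betw_inv_into_left)
  qed
  show ?thesis
    using ring_iso_set_trans[OF g k] gs ga assms(3) by (simp add: algebra_iso_def)
qed

text \<open>Preservation of zero is a separate hypothesis because the zero of the target is only a
  field of a record as long as the target is not known to be a ring, so that additivity does not yet
  determine it.\<close>

lemma assoc_algebra_transport: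
  assumes "assoc_algebra R E" and h: "h \<in> algebra_iso R E A" and zero: "h \<zero>\<^bsub>E\<^esub> = \<zero>\<^bsub>A\<^esub>"
  shows "assoc_algebra R A"
proof -
  interpret E: assoc_algebra R E by fact
  have iso: "h \<in> ring_iso E A"
    using h by (simp add: algebra_iso_def)
  interpret A: ring A
    using E.ring_iso_imp_img_ring[OF iso] unfolding zero by simp
  have hom: "h \<in> ring_hom E A" and surj: "h ` carrier E = carrier A"
    using iso by (auto simp: ring_iso_def bij_betw_def)
  have smult: "c \<odot>\<^bsub>A\<^esub> h x = h (c \<odot>\<^bsub>E\<^esub> x)" if "c \<in> carrier R" "x \<in> carrier E" for c x
    using h that by (simp add: algebra_iso_def)
  note h_simps = smult ring_hom_add[OF hom, symmetric] ring_hom_mult[OF hom, symmetric]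
    ring_hom_closed[OF hom]
  have preimage: "\<exists>x\<in>carrier E. y = h x" if "y \<in> carrier A" for y
    using that surj by auto
  show ?thesis
  proof (rule assoc_algebra.intro[OF moduleI _ assoc_algebra_axioms.intro])
    show "cring R" by (rule E.R.is_cring)
    show "abelian_group A" by (rule A.is_abelian_group)
    show "ring A" by (rule A.ring_axioms)
    fix a b x y
    show "a \<odot>\<^bsub>A\<^esub> x \<in> carrier A" if "a \<in> carrier R" "x \<in> carrier A"
      using that by (auto dest!: preimage simp: h_simps)
    show "(a \<oplus>\<^bsub>R\<^esub> b) \<odot>\<^bsub>A\<^esub> x = a \<odot>\<^bsub>A\<^esub> x \<oplus>\<^bsub>A\<^esub> b \<odot>\<^bsub>A\<^esub> x"
      if "a \<in> carrier R" "b \<in> carrier R" "x \<in> carrier A"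
      using that by (auto dest!: preimage simp: h_simps E.smult_l_distr)
    show "a \<odot>\<^bsub>A\<^esub> (x \<oplus>\<^bsub>A\<^esub> y) = a \<odot>\<^bsub>A\<^esub> x \<oplus>\<^bsub>A\<^esub> a \<odot>\<^bsub>A\<^esub> y"
      if "a \<in> carrier R" "x \<in> carrier A" "y \<in> carrier A"
      using that by (auto dest!: preimage simp: h_simps E.smult_r_distr)
    show "(a \<otimes>\<^bsub>R\<^esub> b) \<odot>\<^bsub>A\<^esub> x = a \<odot>\<^bsub>A\<^esub> (b \<odot>\<^bsub>A\<^esub> x)"
      if "a \<in> carrier R" "b \<in> carrier R" "x \<in> carrier A"
      using that by (auto dest!: preimage simp: h_simps E.smult_assoc1)
    show "\<one>\<^bsub>R\<^esub> \<odot>\<^bsub>A\<^esub> x = x" if "x \<in> carrier A"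
      using that by (auto dest!: preimage simp: h_simps)
    show "(a \<odot>\<^bsub>A\<^esub> x) \<otimes>\<^bsub>A\<^esub> y = a \<odot>\<^bsub>A\<^esub> (x \<otimes>\<^bsub>A\<^esub> y)"
      if "a \<in> carrier R" "x \<in> carrier A" "y \<in> carrier A"
      using that by (auto dest!: preimage simp: h_simps E.smult_mult_left)
    show "x \<otimes>\<^bsub>A\<^esub> (a \<odot>\<^bsub>A\<^esub> y) = a \<odot>\<^bsub>A\<^esub> (x \<otimes>\<^bsub>A\<^esub> y)"
      if "a \<in> carrier R" "x \<in> carrier A" "y \<in> carrier A"
      using that by (auto dest!: preimage simp: h_simps E.smult_mult_right)
  qed
qed

text \<open>Laws are required only of representatives that \<open>\<Phi>\<close> sends into \<open>E\<close>. A polynomial need not act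
  linearly, so for polynomials \<open>\<Phi>\<close> maps to all functions and \<open>E\<close> is only a part of its
  range.\<close>

locale algebra_presentation =
  E: assoc_algebra R E + P: abelian_subgroup N P
  for R :: "('a, 'r) ring_scheme" and E :: "('a, 'e, 'm) module_scheme"
    and N :: "'p set" and P :: "('a, 'p, 'n) module_scheme" +
  fixes \<Phi> :: "'p \<Rightarrow> 'e" and mul :: "'p \<Rightarrow> 'p \<Rightarrow> 'p"
  assumes coset:
      "\<lbrakk> f \<in> carrier P; \<Phi> f \<in> carrier E \<rbrakk> \<Longrightarrow> N +>\<^bsub>P\<^esub> f = {h \<in> carrier P. \<Phi> h = \<Phi> f}"
    and surj: "\<phi> \<in> carrier E \<Longrightarrow> \<exists>f\<in>carrier P. \<Phi> f = \<phi>"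
    and zero: "\<Phi> \<zero>\<^bsub>P\<^esub> = \<zero>\<^bsub>E\<^esub>"
    and add: "\<lbrakk> f \<in> carrier P; \<Phi> f \<in> carrier E; g \<in> carrier P; \<Phi> g \<in> carrier E \<rbrakk> \<Longrightarrow>
        \<Phi> (f \<oplus>\<^bsub>P\<^esub> g) = \<Phi> f \<oplus>\<^bsub>E\<^esub> \<Phi> g"
    and smult: "\<lbrakk> c \<in> carrier R; f \<in> carrier P; \<Phi> f \<in> carrier E \<rbrakk> \<Longrightarrow>
        c \<odot>\<^bsub>P\<^esub> f \<in> carrier P \<and> \<Phi> (c \<odot>\<^bsub>P\<^esub> f) = c \<odot>\<^bsub>E\<^esub> \<Phi> f"
    and mult: "\<lbrakk> f \<in> carrier P; \<Phi> f \<in> carrier E; g \<in> carrier P; \<Phi> g \<in> carrier E \<rbrakk> \<Longrightarrow>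
        mul f g \<in> carrier P \<and> \<Phi> (mul f g) = \<Phi> f \<otimes>\<^bsub>E\<^esub> \<Phi> g"
begin

definition fibre :: "'e \<Rightarrow> 'p set"
  where "fibre \<phi> = {f \<in> carrier P. \<Phi> f = \<phi>}"

text \<open>The unit is given as a fibre, so that no representative of it has to be singled out.\<close>

definition coset_algebra :: "('a, 'p set) module"
  where "coset_algebra =
    \<lparr>carrier = {N +>\<^bsub>P\<^esub> f | f. f \<in> carrier P \<and> \<Phi> f \<in> carrier E},
     monoid.mult = (\<lambda>A B. \<Union>f\<in>A. \<Union>g\<in>B. N +>\<^bsub>P\<^esub> mul f g),
     one = fibre \<one>\<^bsub>E\<^esub>,
     zero = N,
     add = set_add P,
     smult = coset_smult P N\<rparr>"

lemma coset_eq_fibre: "\<lbrakk> f \<in> carrier P; \<Phi> f \<in> carrier E \<rbrakk> \<Longrightarrow> N +>\<^bsub>P\<^esub> f = fibre (\<Phi> f)"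
  by (simp add: coset fibre_def)

lemma fibre_nonempty:
  assumes "\<phi> \<in> carrier E"
  obtains f where "f \<in> carrier P" "\<Phi> f = \<phi>" "f \<in> fibre \<phi>"
  using surj[OF assms] by (auto simp: fibre_def)

text \<open>All representatives contribute the same coset, so the union over them collapses; surjectivity
  of \<open>\<Phi>\<close> is needed to know that the union is not empty.\<close>

lemma fibre_mult:
  assumes "\<phi> \<in> carrier E" "\<psi> \<in> carrier E"
  shows "(\<Union>f\<in>fibre \<phi>. \<Union>g\<in>fibre \<psi>. N +>\<^bsub>P\<^esub> mul f g) = fibre (\<phi> \<otimes>\<^bsub>E\<^esub> \<psi>)"
proof -
  have *: "N +>\<^bsub>P\<^esub> mul f g = fibre (\<phi> \<otimes>\<^bsub>E\<^esub> \<psi>)" if "f \<in> fibre \<phi>" "g \<in> fibre \<psi>" for f g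
    using that assms mult[of f g] coset_eq_fibre[of "mul f g"] by (auto simp: fibre_def)
  obtain f g where "f \<in> fibre \<phi>" "g \<in> fibre \<psi>"
    using assms fibre_nonempty by metis
  then show ?thesis
    using * by blast
qed

lemma fibre_smult:
  assumes "c \<in> carrier R" "\<phi> \<in> carrier E"
  shows "coset_smult P N c (fibre \<phi>) = fibre (c \<odot>\<^bsub>E\<^esub> \<phi>)"
proof -
  have *: "N +>\<^bsub>P\<^esub> (c \<odot>\<^bsub>P\<^esub> f) = fibre (c \<odot>\<^bsub>E\<^esub> \<phi>)" if "f \<in> fibre \<phi>" for f
    using that assms smult[of c f] coset_eq_fibre[of "c \<odot>\<^bsub>P\<^esub> f"] by (auto simp: fibre_def)
  obtain f where "f \<in> fibre \<phi>"
    using assms fibre_nonempty by metis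
  then show ?thesis
    using * by (auto simp: coset_smult_def)
qed

lemma fibre_add:
  assumes "\<phi> \<in> carrier E" "\<psi> \<in> carrier E"
  shows "fibre \<phi> <+>\<^bsub>P\<^esub> fibre \<psi> = fibre (\<phi> \<oplus>\<^bsub>E\<^esub> \<psi>)"
proof -
  obtain f g where f: "f \<in> carrier P" "\<Phi> f = \<phi>" and g: "g \<in> carrier P" "\<Phi> g = \<psi>"
    using assms fibre_nonempty by metis
  have "fibre \<phi> <+>\<^bsub>P\<^esub> fibre \<psi> = N +>\<^bsub>P\<^esub> (f \<oplus>\<^bsub>P\<^esub> g)"
    using P.a_rcos_sum[OF f(1) g(1)] coset_eq_fibre[of f] coset_eq_fibre[of g] f g assms by simp
  then show ?thesis
    using coset_eq_fibre[of "f \<oplus>\<^bsub>P\<^esub> g"] f g assms add[of f g] by simp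
qed

lemma fibre_zero: "fibre \<zero>\<^bsub>E\<^esub> = N"
  using coset_eq_fibre[of "\<zero>\<^bsub>P\<^esub>"] zero P.a_coset_add_zero[OF P.a_subset] by simp

lemma fibre_iso: "fibre \<in> algebra_iso R E coset_algebra"
proof -
  have carrier: "carrier coset_algebra = fibre ` carrier E"
  proof (intro equalityI subsetI)
    fix X assume "X \<in> carrier coset_algebra"
    then show "X \<in> fibre ` carrier E"
      using coset_eq_fibre by (auto simp: coset_algebra_def)
  next
    fix X assume "X \<in> fibre ` carrier E"
    then obtain \<phi> where "\<phi> \<in> carrier E" "X = fibre \<phi>" by blast
    then obtain f where "f \<in> carrier P" "\<Phi> f = \<phi>"
      using fibre_nonempty by metis
    then show "X \<in> carrier coset_algebra"
      using \<open>\<phi> \<in> carrier E\<close> \<open>X = fibre \<phi>\<close> coset_eq_fibre[of f]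
      by (force simp: coset_algebra_def)
  qed
  moreover have "inj_on fibre (carrier E)"
  proof (rule inj_onI)
    fix \<phi> \<psi> assume *: "\<phi> \<in> carrier E" "\<psi> \<in> carrier E" "fibre \<phi> = fibre \<psi>"
    obtain f where "f \<in> fibre \<phi>" using * fibre_nonempty by metis
    then show "\<phi> = \<psi>" using * by (auto simp: fibre_def)
  qed
  ultimately have "fibre \<in> ring_iso E coset_algebra"
    by (auto simp: ring_iso_def ring_hom_def bij_betw_def)
      (simp_all add: coset_algebra_def fibre_mult fibre_add)
  then show ?thesis
    by (simp add: algebra_iso_def) (simp add: coset_algebra_def fibre_smult)
qed

lemma coset_algebra_assoc: "assoc_algebra R coset_algebra"
  by (rule assoc_algebra_transport[OF E.assoc_algebra_axioms fibre_iso])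
    (simp add: fibre_zero coset_algebra_def)

end


section \<open>The algebra of endomorphisms of a module\<close>

lemma finsum_additive:
  assumes "abelian_group G" and "abelian_group H"
    and closed: "\<And>x. x \<in> carrier G \<Longrightarrow> h x \<in> carrier H"
    and add: "\<And>x y. \<lbrakk>x \<in> carrier G; y \<in> carrier G\<rbrakk> \<Longrightarrow> h (x \<oplus>\<^bsub>G\<^esub> y) = h x \<oplus>\<^bsub>H\<^esub> h y"
    and f: "f \<in> I \<rightarrow> carrier G"
  shows "h (\<Oplus>\<^bsub>G\<^esub>i\<in>I. f i) = (\<Oplus>\<^bsub>H\<^esub>i\<in>I. h (f i))"
proof -
  interpret G: abelian_group G by fact
  interpret H: abelian_group H by fact
  have "h \<zero>\<^bsub>G\<^esub> \<oplus>\<^bsub>H\<^esub> h \<zero>\<^bsub>G\<^esub> = h \<zero>\<^bsub>G\<^esub>"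
    using add[of "\<zero>\<^bsub>G\<^esub>" "\<zero>\<^bsub>G\<^esub>"] by simp
  then have zero: "h \<zero>\<^bsub>G\<^esub> = \<zero>\<^bsub>H\<^esub>"
    using closed[of "\<zero>\<^bsub>G\<^esub>"] H.add.l_cancel_one[of "h \<zero>\<^bsub>G\<^esub>" "h \<zero>\<^bsub>G\<^esub>"] by simp
  show ?thesis
    using f
  proof (induction I rule: infinite_finite_induct)
    case (insert i I)
    then have "f i \<in> carrier G" "f \<in> I \<rightarrow> carrier G" by auto
    with insert show ?case
      using closed by (simp add: add G.finsum_closed Pi_def)
  qed (simp_all add: zero)
qed

definition End_algebra ::
    "('a, 'r) ring_scheme \<Rightarrow> ('a, 'v, 'm) module_scheme \<Rightarrow> ('a, 'v \<Rightarrow> 'v) module"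
  where "End_algebra R V =
    \<lparr>carrier = {f \<in> carrier V \<rightarrow>\<^sub>E carrier V.
        (\<forall>x\<in>carrier V. \<forall>y\<in>carrier V. f (x \<oplus>\<^bsub>V\<^esub> y) = f x \<oplus>\<^bsub>V\<^esub> f y) \<and>
        (\<forall>c\<in>carrier R. \<forall>x\<in>carrier V. f (c \<odot>\<^bsub>V\<^esub> x) = c \<odot>\<^bsub>V\<^esub> f x)},
     monoid.mult = (\<lambda>f g. \<lambda>x\<in>carrier V. f (g x)),
     one = (\<lambda>x\<in>carrier V. x),
     zero = (\<lambda>x\<in>carrier V. \<zero>\<^bsub>V\<^esub>),
     add = (\<lambda>f g. \<lambda>x\<in>carrier V. f x \<oplus>\<^bsub>V\<^esub> g x),
     smult = (\<lambda>c f. \<lambda>x\<in>carrier V. c \<odot>\<^bsub>V\<^esub> f x)\<rparr>"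

lemma End_carrier:
  "f \<in> carrier (End_algebra R V) \<longleftrightarrow> f \<in> carrier V \<rightarrow>\<^sub>E carrier V \<and>
    (\<forall>x\<in>carrier V. \<forall>y\<in>carrier V. f (x \<oplus>\<^bsub>V\<^esub> y) = f x \<oplus>\<^bsub>V\<^esub> f y) \<and>
    (\<forall>c\<in>carrier R. \<forall>x\<in>carrier V. f (c \<odot>\<^bsub>V\<^esub> x) = c \<odot>\<^bsub>V\<^esub> f x)"
  by (simp add: End_algebra_def)

lemma End_linear:
  assumes "f \<in> carrier (End_algebra R V)" and "x \<in> carrier V"
  shows "y \<in> carrier V \<Longrightarrow> f (x \<oplus>\<^bsub>V\<^esub> y) = f x \<oplus>\<^bsub>V\<^esub> f y"
    and "c \<in> carrier R \<Longrightarrow> f (c \<odot>\<^bsub>V\<^esub> x) = c \<odot>\<^bsub>V\<^esub> f x"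
  using assms by (auto simp: End_carrier)

lemma End_apply_closed: "\<lbrakk>f \<in> carrier (End_algebra R V); x \<in> carrier V\<rbrakk> \<Longrightarrow> f x \<in> carrier V"
  by (auto simp: End_carrier)

lemma End_apply:
  "x \<in> carrier V \<Longrightarrow> (f \<otimes>\<^bsub>End_algebra R V\<^esub> g) x = f (g x)"
  "x \<in> carrier V \<Longrightarrow> (f \<oplus>\<^bsub>End_algebra R V\<^esub> g) x = f x \<oplus>\<^bsub>V\<^esub> g x"
  "x \<in> carrier V \<Longrightarrow> (c \<odot>\<^bsub>End_algebra R V\<^esub> f) x = c \<odot>\<^bsub>V\<^esub> f x"
  "x \<in> carrier V \<Longrightarrow> \<zero>\<^bsub>End_algebra R V\<^esub> x = \<zero>\<^bsub>V\<^esub>"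
  "x \<in> carrier V \<Longrightarrow> \<one>\<^bsub>End_algebra R V\<^esub> x = x"
  by (simp_all add: End_algebra_def)

lemma End_eqI:
  assumes "f \<in> carrier (End_algebra R V)" "g \<in> carrier (End_algebra R V)"
    and "\<And>x. x \<in> carrier V \<Longrightarrow> f x = g x"
  shows "f = g"
  using assms by (auto simp: End_carrier intro: PiE_ext)

lemma (in module) End_closed:
  "\<lbrakk>f \<in> carrier (End_algebra R M); g \<in> carrier (End_algebra R M)\<rbrakk> \<Longrightarrow>
    f \<otimes>\<^bsub>End_algebra R M\<^esub> g \<in> carrier (End_algebra R M)"
  "\<lbrakk>f \<in> carrier (End_algebra R M); g \<in> carrier (End_algebra R M)\<rbrakk> \<Longrightarrow>
    f \<oplus>\<^bsub>End_algebra R M\<^esub> g \<in> carrier (End_algebra R M)"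
  "\<lbrakk>c \<in> carrier R; f \<in> carrier (End_algebra R M)\<rbrakk> \<Longrightarrow>
    c \<odot>\<^bsub>End_algebra R M\<^esub> f \<in> carrier (End_algebra R M)"
  "\<zero>\<^bsub>End_algebra R M\<^esub> \<in> carrier (End_algebra R M)"
  "\<one>\<^bsub>End_algebra R M\<^esub> \<in> carrier (End_algebra R M)"
proof -
  show "f \<otimes>\<^bsub>End_algebra R M\<^esub> g \<in> carrier (End_algebra R M)"
    if "f \<in> carrier (End_algebra R M)" "g \<in> carrier (End_algebra R M)"
    using that unfolding End_algebra_def by (auto simp: PiE_iff)
  show "f \<oplus>\<^bsub>End_algebra R M\<^esub> g \<in> carrier (End_algebra R M)"
    if "f \<in> carrier (End_algebra R M)" "g \<in> carrier (End_algebra R M)"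
    using that unfolding End_algebra_def
    by (auto simp: PiE_iff smult_r_distr M.a_ac)
  show "c \<odot>\<^bsub>End_algebra R M\<^esub> f \<in> carrier (End_algebra R M)"
    if "c \<in> carrier R" "f \<in> carrier (End_algebra R M)"
    using that unfolding End_algebra_def
    by (auto simp: PiE_iff smult_r_distr R.m_comm smult_assoc1[symmetric])
  show "\<zero>\<^bsub>End_algebra R M\<^esub> \<in> carrier (End_algebra R M)"
    "\<one>\<^bsub>End_algebra R M\<^esub> \<in> carrier (End_algebra R M)"
    unfolding End_algebra_def by auto
qed

lemma (in module) End_assoc_algebra: "assoc_algebra R (End_algebra R M)" (is "assoc_algebra R ?E")
proof (rule assoc_algebra.intro[OF moduleI _ assoc_algebra_axioms.intro])
  note [simp] = End_closed End_apply End_apply_closed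
  show "cring R" by (rule R.is_cring)
  have neg: "\<exists>g\<in>carrier ?E. g \<oplus>\<^bsub>?E\<^esub> f = \<zero>\<^bsub>?E\<^esub>" if f: "f \<in> carrier ?E" for f
  proof
    show "(\<ominus> \<one>) \<odot>\<^bsub>?E\<^esub> f \<in> carrier ?E" using f by simp
    show "(\<ominus> \<one>) \<odot>\<^bsub>?E\<^esub> f \<oplus>\<^bsub>?E\<^esub> f = \<zero>\<^bsub>?E\<^esub>"
      by (rule End_eqI[where R = R and V = M]) (use f in \<open>simp_all add: smult_l_minus M.l_neg\<close>)
  qed
  show grp: "abelian_group ?E"
    by (rule abelian_groupI; (rule neg)?)
      (auto intro!: End_eqI[where R = R and V = M] simp: M.a_ac)
  show "ring ?E"
  proof (rule ringI[OF grp])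
    show "monoid ?E"
      by (rule monoidI) (auto intro!: End_eqI[where R = R and V = M])
  qed (auto intro!: End_eqI[where R = R and V = M] simp: End_linear)
qed (auto intro!: End_eqI[where R = R and V = M]
    simp: End_closed End_apply End_apply_closed End_linear smult_l_distr smult_r_distr smult_assoc1)

lemma (in module) End_finsum_apply:
  assumes "f \<in> I \<rightarrow> carrier (End_algebra R M)" and "x \<in> carrier M"
  shows "(\<Oplus>\<^bsub>End_algebra R M\<^esub>i\<in>I. f i) x = (\<Oplus>\<^bsub>M\<^esub>i\<in>I. f i x)"
proof -
  interpret E: assoc_algebra R "End_algebra R M" by (rule End_assoc_algebra)
  show ?thesis
    by (rule finsum_additive[OF E.is_abelian_group M.abelian_group_axioms, where h = "\<lambda>f. f x"])
      (use assms in \<open>auto simp: End_apply End_apply_closed\<close>)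
qed


section \<open>Free modules and linear extension\<close>

lemma free_carrier:
  "f \<in> carrier (free_module R S) \<longleftrightarrow> f \<in> S \<rightarrow>\<^sub>E carrier R \<and> finite {s \<in> S. f s \<noteq> \<zero>\<^bsub>R\<^esub>}"
  by (simp add: free_module_def)

lemma free_apply_closed: "\<lbrakk>f \<in> carrier (free_module R S); s \<in> S\<rbrakk> \<Longrightarrow> f s \<in> carrier R"
  by (auto simp: free_carrier)

lemma free_support_finite: "f \<in> carrier (free_module R S) \<Longrightarrow> finite {s \<in> S. f s \<noteq> \<zero>\<^bsub>R\<^esub>}"
  by (simp add: free_carrier)

lemma free_apply:
  "s \<in> S \<Longrightarrow> (f \<oplus>\<^bsub>free_module R S\<^esub> g) s = f s \<oplus>\<^bsub>R\<^esub> g s"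
  "s \<in> S \<Longrightarrow> (c \<odot>\<^bsub>free_module R S\<^esub> f) s = c \<otimes>\<^bsub>R\<^esub> f s"
  "s \<in> S \<Longrightarrow> \<zero>\<^bsub>free_module R S\<^esub> s = \<zero>\<^bsub>R\<^esub>"
  by (simp_all add: free_module_def)

lemma free_eqI:
  assumes "f \<in> carrier (free_module R S)" "g \<in> carrier (free_module R S)"
    and "\<And>s. s \<in> S \<Longrightarrow> f s = g s"
  shows "f = g"
  using assms by (auto simp: free_carrier intro: PiE_ext)

context cring
begin

lemma free_closed:
  "\<lbrakk>f \<in> carrier (free_module R S); g \<in> carrier (free_module R S)\<rbrakk> \<Longrightarrow>
    f \<oplus>\<^bsub>free_module R S\<^esub> g \<in> carrier (free_module R S)"
  "\<lbrakk>c \<in> carrier R; f \<in> carrier (free_module R S)\<rbrakk> \<Longrightarrow>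
    c \<odot>\<^bsub>free_module R S\<^esub> f \<in> carrier (free_module R S)"
  "\<zero>\<^bsub>free_module R S\<^esub> \<in> carrier (free_module R S)"
  "free_gen R S t \<in> carrier (free_module R S)"
proof -
  show "f \<oplus>\<^bsub>free_module R S\<^esub> g \<in> carrier (free_module R S)"
    if f: "f \<in> carrier (free_module R S)" and g: "g \<in> carrier (free_module R S)"
  proof -
    have "finite {s \<in> S. f s \<oplus> g s \<noteq> \<zero>}"
      by (rule finite_subset[OF _ finite_UnI[OF free_support_finite[OF f] free_support_finite[OF g]]])
        auto
    then have "finite {s \<in> S. (f \<oplus>\<^bsub>free_module R S\<^esub> g) s \<noteq> \<zero>}"
      by (simp add: free_apply cong: conj_cong)
    then show ?thesis
      using f g unfolding free_carrier by (auto simp: free_module_def PiE_iff)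
  qed
  show "c \<odot>\<^bsub>free_module R S\<^esub> f \<in> carrier (free_module R S)"
    if c: "c \<in> carrier R" and f: "f \<in> carrier (free_module R S)"
  proof -
    have "finite {s \<in> S. c \<otimes> f s \<noteq> \<zero>}"
      by (rule finite_subset[OF _ free_support_finite[OF f]]) (use c in auto)
    then have "finite {s \<in> S. (c \<odot>\<^bsub>free_module R S\<^esub> f) s \<noteq> \<zero>}"
      by (simp add: free_apply cong: conj_cong)
    then show ?thesis
      using c f unfolding free_carrier by (auto simp: free_module_def PiE_iff)
  qed
  show "\<zero>\<^bsub>free_module R S\<^esub> \<in> carrier (free_module R S)"
    by (auto simp: free_module_def)
  have "finite {s \<in> S. free_gen R S t s \<noteq> \<zero>}"
    by (rule finite_subset[of _ "{t}"]) (auto simp: free_gen_def)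
  then show "free_gen R S t \<in> carrier (free_module R S)"
    unfolding free_carrier by (auto simp: free_gen_def)
qed

lemma free_module_is_module: "module R (free_module R S)" (is "module R ?T")
proof (rule moduleI)
  note [simp] = free_closed free_apply free_apply_closed[of _ R S]
  have neg: "\<exists>g\<in>carrier ?T. g \<oplus>\<^bsub>?T\<^esub> f = \<zero>\<^bsub>?T\<^esub>" if f: "f \<in> carrier ?T" for f
  proof
    show "(\<ominus> \<one>) \<odot>\<^bsub>?T\<^esub> f \<in> carrier ?T" using f by simp
    show "(\<ominus> \<one>) \<odot>\<^bsub>?T\<^esub> f \<oplus>\<^bsub>?T\<^esub> f = \<zero>\<^bsub>?T\<^esub>"
      by (rule free_eqI[where R = R and S = S]) (use f in \<open>simp_all add: l_minus l_neg\<close>)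
  qed
  show "abelian_group ?T"
    by (rule abelian_groupI; (rule neg)?) (auto intro!: free_eqI[where R = R and S = S] simp: a_ac)
qed (auto intro!: free_eqI[where R = R and S = S]
    simp: is_cring free_closed free_apply free_apply_closed l_distr r_distr m_assoc)

text \<open>Removing one point from the support at a time exhausts a finitely supported function.\<close>

lemma free_module_induct [consumes 1, case_names zero gen add]:
  assumes "f \<in> carrier (free_module R S)"
    and zero: "Q \<zero>\<^bsub>free_module R S\<^esub>"
    and gen: "\<And>c s. \<lbrakk>c \<in> carrier R; s \<in> S\<rbrakk> \<Longrightarrow> Q (c \<odot>\<^bsub>free_module R S\<^esub> free_gen R S s)"
    and add: "\<And>f g. \<lbrakk>f \<in> carrier (free_module R S); g \<in> carrier (free_module R S); Q f; Q g\<rbrakk>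
      \<Longrightarrow> Q (f \<oplus>\<^bsub>free_module R S\<^esub> g)"
  shows "Q f"
proof -
  have "Q f" if "finite A" "f \<in> carrier (free_module R S)" "{s \<in> S. f s \<noteq> \<zero>} = A" for A f
    using that
  proof (induction A arbitrary: f rule: finite_induct)
    case empty
    then have "f = \<zero>\<^bsub>free_module R S\<^esub>"
      by (intro free_eqI[where R = R and S = S]) (auto simp: free_closed free_apply)
    then show ?case using zero by simp
  next
    case (insert t A)
    let ?g = "\<lambda>s\<in>S. if s = t then \<zero> else f s"
    have t: "t \<in> S" and ft: "f t \<in> carrier R"
      using insert free_apply_closed[of f R S t] by auto
    have supp: "{s \<in> S. ?g s \<noteq> \<zero>} = A"
      using insert by auto
    have g: "?g \<in> carrier (free_module R S)"
      using insert.prems(1) insert.hyps(1) supp unfolding free_carrier by (simp add: PiE_iff)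
    have decomp: "f t \<odot>\<^bsub>free_module R S\<^esub> free_gen R S t \<oplus>\<^bsub>free_module R S\<^esub> ?g = f"
    proof (rule free_eqI[where R = R and S = S])
      fix s assume "s \<in> S"
      then show "(f t \<odot>\<^bsub>free_module R S\<^esub> free_gen R S t \<oplus>\<^bsub>free_module R S\<^esub> ?g) s = f s"
        using ft free_apply_closed[of f R S s] insert.prems by (auto simp: free_apply free_gen_def)
    qed (use insert.prems ft g in \<open>simp_all add: free_closed\<close>)
    have "Q (f t \<odot>\<^bsub>free_module R S\<^esub> free_gen R S t \<oplus>\<^bsub>free_module R S\<^esub> ?g)"
      by (rule add[OF _ g gen[OF ft t] insert.IH[OF g supp]]) (simp add: ft free_closed)
    then show ?case
      by (simp only: decomp)
  qed
  then show ?thesis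
    using assms(1) free_support_finite by blast
qed

end

text \<open>The map on the free module induced by a family \<open>u\<close> of vectors, by its universal property.\<close>

definition linear_extension ::
    "('a, 'r) ring_scheme \<Rightarrow> ('a, 'v, 'm) module_scheme \<Rightarrow> 's set \<Rightarrow> ('s \<Rightarrow> 'v) \<Rightarrow> ('s \<Rightarrow> 'a) \<Rightarrow> 'v"
  where "linear_extension R M S u f = (\<Oplus>\<^bsub>M\<^esub>s\<in>{s \<in> S. f s \<noteq> \<zero>\<^bsub>R\<^esub>}. f s \<odot>\<^bsub>M\<^esub> u s)"

context module
begin

text \<open>Sums over different supports can only be compared on a common finite index set.\<close>

lemma linear_extension_superset:
  assumes u: "u \<in> S \<rightarrow> carrier M" and f: "f \<in> carrier (free_module R S)"
    and B: "finite B" "{s \<in> S. f s \<noteq> \<zero>} \<subseteq> B" "B \<subseteq> S"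
  shows "linear_extension R M S u f = (\<Oplus>\<^bsub>M\<^esub>s\<in>B. f s \<odot>\<^bsub>M\<^esub> u s)"
  unfolding linear_extension_def
  by (rule M.add.finprod_mono_neutral_cong_left[OF B(1,2)])
    (use u B(3) free_apply_closed[OF f] in \<open>auto simp: subset_iff Pi_iff\<close>)

lemma linear_extension_closed:
  assumes "u \<in> S \<rightarrow> carrier M" and "f \<in> carrier (free_module R S)"
  shows "linear_extension R M S u f \<in> carrier M"
  unfolding linear_extension_def
  by (rule M.finsum_closed) (use assms free_apply_closed[OF assms(2)] in auto)

lemma linear_extension_add:
  assumes u: "u \<in> S \<rightarrow> carrier M"
    and f: "f \<in> carrier (free_module R S)" and g: "g \<in> carrier (free_module R S)"
  shows "linear_extension R M S u (f \<oplus>\<^bsub>free_module R S\<^esub> g) =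
    linear_extension R M S u f \<oplus>\<^bsub>M\<^esub> linear_extension R M S u g"
proof -
  let ?B = "{s \<in> S. f s \<noteq> \<zero>} \<union> {s \<in> S. g s \<noteq> \<zero>}"
  have B: "finite ?B" "?B \<subseteq> S"
    using free_support_finite[OF f] free_support_finite[OF g] by auto
  have fg: "f \<oplus>\<^bsub>free_module R S\<^esub> g \<in> carrier (free_module R S)"
    using f g by (rule R.free_closed)
  have "linear_extension R M S u (f \<oplus>\<^bsub>free_module R S\<^esub> g) =
      (\<Oplus>\<^bsub>M\<^esub>s\<in>?B. (f \<oplus>\<^bsub>free_module R S\<^esub> g) s \<odot>\<^bsub>M\<^esub> u s)"
    by (rule linear_extension_superset[OF u fg B(1) _ B(2)]) (auto simp: free_apply)
  also have "\<dots> = (\<Oplus>\<^bsub>M\<^esub>s\<in>?B. f s \<odot>\<^bsub>M\<^esub> u s \<oplus>\<^bsub>M\<^esub> g s \<odot>\<^bsub>M\<^esub> u s)"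
    by (rule M.finsum_cong')
      (use u free_apply_closed[OF f] free_apply_closed[OF g] in
        \<open>auto simp: free_apply smult_l_distr Pi_iff\<close>)
  also have "\<dots> = (\<Oplus>\<^bsub>M\<^esub>s\<in>?B. f s \<odot>\<^bsub>M\<^esub> u s) \<oplus>\<^bsub>M\<^esub> (\<Oplus>\<^bsub>M\<^esub>s\<in>?B. g s \<odot>\<^bsub>M\<^esub> u s)"
    by (rule M.finsum_addf)
      (use u free_apply_closed[OF f] free_apply_closed[OF g] in \<open>auto simp: Pi_iff\<close>)
  also have "(\<Oplus>\<^bsub>M\<^esub>s\<in>?B. f s \<odot>\<^bsub>M\<^esub> u s) = linear_extension R M S u f"
    by (rule linear_extension_superset[OF u f B(1) _ B(2), symmetric]) auto
  also have "(\<Oplus>\<^bsub>M\<^esub>s\<in>?B. g s \<odot>\<^bsub>M\<^esub> u s) = linear_extension R M S u g"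
    by (rule linear_extension_superset[OF u g B(1) _ B(2), symmetric]) auto
  finally show ?thesis .
qed

lemma linear_extension_smult:
  assumes u: "u \<in> S \<rightarrow> carrier M" and c: "c \<in> carrier R" and f: "f \<in> carrier (free_module R S)"
  shows "linear_extension R M S u (c \<odot>\<^bsub>free_module R S\<^esub> f) = c \<odot>\<^bsub>M\<^esub> linear_extension R M S u f"
proof -
  let ?B = "{s \<in> S. f s \<noteq> \<zero>}"
  have B: "finite ?B" "?B \<subseteq> S"
    using free_support_finite[OF f] by auto
  have cf: "c \<odot>\<^bsub>free_module R S\<^esub> f \<in> carrier (free_module R S)"
    using c f by (rule R.free_closed)
  have "linear_extension R M S u (c \<odot>\<^bsub>free_module R S\<^esub> f) =
      (\<Oplus>\<^bsub>M\<^esub>s\<in>?B. (c \<odot>\<^bsub>free_module R S\<^esub> f) s \<odot>\<^bsub>M\<^esub> u s)"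
    by (rule linear_extension_superset[OF u cf B(1) _ B(2)]) (use c in \<open>auto simp: free_apply\<close>)
  also have "\<dots> = (\<Oplus>\<^bsub>M\<^esub>s\<in>?B. c \<odot>\<^bsub>M\<^esub> (f s \<odot>\<^bsub>M\<^esub> u s))"
    by (rule M.finsum_cong')
      (use u c free_apply_closed[OF f] in \<open>auto simp: free_apply smult_assoc1 Pi_iff\<close>)
  also have "\<dots> = c \<odot>\<^bsub>M\<^esub> linear_extension R M S u f"
    unfolding linear_extension_def
    by (rule finsum_smult_ldistr[symmetric])
      (use u c B free_apply_closed[OF f] in \<open>auto simp: Pi_iff\<close>)
  finally show ?thesis .
qed

lemma linear_extension_gen:
  assumes u: "u \<in> S \<rightarrow> carrier M" and t: "t \<in> S"
  shows "linear_extension R M S u (free_gen R S t) = u t"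
proof -
  have "linear_extension R M S u (free_gen R S t) = (\<Oplus>\<^bsub>M\<^esub>s\<in>{t}. free_gen R S t s \<odot>\<^bsub>M\<^esub> u s)"
    by (rule linear_extension_superset[OF u R.free_closed(4)])
      (use t in \<open>auto simp: free_gen_def split: if_splits\<close>)
  then show ?thesis
    using u t by (simp add: free_gen_def Pi_iff)
qed

end


section \<open>Congruence modulo a submodule\<close>

context module
begin

definition congruent_mod :: "'c set \<Rightarrow> 'c \<Rightarrow> 'c \<Rightarrow> bool"
  where "congruent_mod H x y \<longleftrightarrow> x \<in> carrier M \<and> y \<in> carrier M \<and> x \<ominus>\<^bsub>M\<^esub> y \<in> H"

context
  fixes H
  assumes H: "submodule H R M"
begin

lemma congruent_mod_refl: "x \<in> carrier M \<Longrightarrow> congruent_mod H x x"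
  using H by (simp add: congruent_mod_def a_minus_def M.r_neg
      subgroup.one_closed[OF submodule.axioms(1), simplified])

lemma congruent_mod_sym: "congruent_mod H x y \<Longrightarrow> congruent_mod H y x"
  using submoduleE(3)[OF H, of "x \<ominus>\<^bsub>M\<^esub> y"]
  by (auto simp: congruent_mod_def a_minus_def M.minus_add M.a_comm)

lemma congruent_mod_trans:
  assumes "congruent_mod H x y" and "congruent_mod H y z"
  shows "congruent_mod H x z"
proof -
  have "x \<ominus>\<^bsub>M\<^esub> z = (x \<ominus>\<^bsub>M\<^esub> y) \<oplus>\<^bsub>M\<^esub> (y \<ominus>\<^bsub>M\<^esub> z)"
    using assms by (simp add: congruent_mod_def a_minus_def M.a_ac M.r_neg2 M.r_neg1)
  then show ?thesis
    using assms submoduleE(5)[OF H] by (simp add: congruent_mod_def)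
qed

lemma congruent_mod_add:
  assumes "congruent_mod H x y" and "congruent_mod H x' y'"
  shows "congruent_mod H (x \<oplus>\<^bsub>M\<^esub> x') (y \<oplus>\<^bsub>M\<^esub> y')"
proof -
  have "(x \<oplus>\<^bsub>M\<^esub> x') \<ominus>\<^bsub>M\<^esub> (y \<oplus>\<^bsub>M\<^esub> y') = (x \<ominus>\<^bsub>M\<^esub> y) \<oplus>\<^bsub>M\<^esub> (x' \<ominus>\<^bsub>M\<^esub> y')"
    using assms by (simp add: congruent_mod_def a_minus_def M.a_ac M.minus_add)
  then show ?thesis
    using assms submoduleE(5)[OF H] by (simp add: congruent_mod_def)
qed

lemma congruent_mod_smult:
  assumes "c \<in> carrier R" and "congruent_mod H x y"
  shows "congruent_mod H (c \<odot>\<^bsub>M\<^esub> x) (c \<odot>\<^bsub>M\<^esub> y)"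
proof -
  have "c \<odot>\<^bsub>M\<^esub> x \<ominus>\<^bsub>M\<^esub> c \<odot>\<^bsub>M\<^esub> y = c \<odot>\<^bsub>M\<^esub> (x \<ominus>\<^bsub>M\<^esub> y)"
    using assms by (simp add: congruent_mod_def a_minus_def smult_r_distr smult_r_minus)
  then show ?thesis
    using assms submoduleE(4)[OF H] by (simp add: congruent_mod_def)
qed

lemma congruent_mod_finsum:
  assumes "\<And>i. i \<in> I \<Longrightarrow> congruent_mod H (f i) (g i)"
  shows "congruent_mod H (\<Oplus>\<^bsub>M\<^esub>i\<in>I. f i) (\<Oplus>\<^bsub>M\<^esub>i\<in>I. g i)"
  using assms
proof (induction I rule: infinite_finite_induct)
  case (insert i I)
  then have "congruent_mod H (f i \<oplus>\<^bsub>M\<^esub> (\<Oplus>\<^bsub>M\<^esub>i\<in>I. f i)) (g i \<oplus>\<^bsub>M\<^esub> (\<Oplus>\<^bsub>M\<^esub>i\<in>I. g i))"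
    by (intro congruent_mod_add) auto
  moreover have "f \<in> I \<rightarrow> carrier M" "g \<in> I \<rightarrow> carrier M" "f i \<in> carrier M" "g i \<in> carrier M"
    using insert.prems by (auto simp: congruent_mod_def)
  ultimately show ?case
    using insert.hyps by simp
qed (simp_all add: congruent_mod_refl)

end

end


section \<open>The composition algebra of a module with a dual basis\<close>

text \<open>The product on formal combinations is a single sum over pairs; this lemma turns it into a
  product of two realizations.\<close>

lemma (in ring) finsum_mult_finsum:
  assumes "finite A" and "finite B" and f: "f \<in> A \<rightarrow> carrier R" and g: "g \<in> B \<rightarrow> carrier R"
  shows "(\<Oplus>i\<in>A. f i) \<otimes> (\<Oplus>j\<in>B. g j) = (\<Oplus>p\<in>A \<times> B. f (fst p) \<otimes> g (snd p))"
  using assms(1) f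
proof (induction A rule: finite_induct)
  case empty
  then show ?case using g by simp
next
  case (insert i A)
  have fi: "f i \<in> carrier R" and fA: "f \<in> A \<rightarrow> carrier R"
    using insert.prems by auto
  have "(\<Oplus>p\<in>insert i A \<times> B. f (fst p) \<otimes> g (snd p)) =
      (\<Oplus>p\<in>Pair i ` B \<union> A \<times> B. f (fst p) \<otimes> g (snd p))"
    by (rule arg_cong[of _ _ "finsum R (\<lambda>p. f (fst p) \<otimes> g (snd p))"]) auto
  also have "\<dots> = (\<Oplus>p\<in>Pair i ` B. f (fst p) \<otimes> g (snd p)) \<oplus> (\<Oplus>p\<in>A \<times> B. f (fst p) \<otimes> g (snd p))"
    by (rule finsum_Un_disjoint) (use insert.hyps assms(2) fi fA g in \<open>auto simp: Pi_iff\<close>)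
  also have "(\<Oplus>p\<in>Pair i ` B. f (fst p) \<otimes> g (snd p)) = (\<Oplus>j\<in>B. f i \<otimes> g j)"
    using fi g by (subst finsum_reindex) (auto simp: inj_on_def Pi_iff)
  also have "\<dots> = f i \<otimes> (\<Oplus>j\<in>B. g j)"
    by (rule finsum_rdistr[symmetric]) (use assms(2) fi g in auto)
  finally show ?case
    using insert.IH[OF fA] insert.hyps fi fA g by (simp add: l_distr finsum_closed)
qed

lemma dual_carrier:
  "l \<in> carrier (dual_module R V) \<longleftrightarrow> l \<in> carrier V \<rightarrow>\<^sub>E carrier R \<and>
    (\<forall>x\<in>carrier V. \<forall>y\<in>carrier V. l (x \<oplus>\<^bsub>V\<^esub> y) = l x \<oplus>\<^bsub>R\<^esub> l y) \<and>
    (\<forall>c\<in>carrier R. \<forall>x\<in>carrier V. l (c \<odot>\<^bsub>V\<^esub> x) = c \<otimes>\<^bsub>R\<^esub> l x)"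
  by (simp add: dual_module_def)

lemma dual_linear:
  assumes "l \<in> carrier (dual_module R V)" and "x \<in> carrier V"
  shows "y \<in> carrier V \<Longrightarrow> l (x \<oplus>\<^bsub>V\<^esub> y) = l x \<oplus>\<^bsub>R\<^esub> l y"
    and "c \<in> carrier R \<Longrightarrow> l (c \<odot>\<^bsub>V\<^esub> x) = c \<otimes>\<^bsub>R\<^esub> l x"
    and "l x \<in> carrier R"
  using assms by (auto simp: dual_carrier)

lemma dual_apply:
  "x \<in> carrier V \<Longrightarrow> (l \<oplus>\<^bsub>dual_module R V\<^esub> m) x = l x \<oplus>\<^bsub>R\<^esub> m x"
  "x \<in> carrier V \<Longrightarrow> (c \<odot>\<^bsub>dual_module R V\<^esub> l) x = c \<otimes>\<^bsub>R\<^esub> l x"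
  by (simp_all add: dual_module_def)

lemma (in cring) dual_closed:
  "\<lbrakk>l \<in> carrier (dual_module R V); m \<in> carrier (dual_module R V)\<rbrakk> \<Longrightarrow>
    l \<oplus>\<^bsub>dual_module R V\<^esub> m \<in> carrier (dual_module R V)"
  "\<lbrakk>c \<in> carrier R; l \<in> carrier (dual_module R V)\<rbrakk> \<Longrightarrow>
    c \<odot>\<^bsub>dual_module R V\<^esub> l \<in> carrier (dual_module R V)"
  if "module R V" for V
proof -
  interpret V: module R V by fact
  show "l \<oplus>\<^bsub>dual_module R V\<^esub> m \<in> carrier (dual_module R V)"
    if "l \<in> carrier (dual_module R V)" "m \<in> carrier (dual_module R V)"
    using that unfolding dual_module_def by (auto simp: PiE_iff r_distr a_ac)
  show "c \<odot>\<^bsub>dual_module R V\<^esub> l \<in> carrier (dual_module R V)"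
    if "c \<in> carrier R" "l \<in> carrier (dual_module R V)"
    using that unfolding dual_module_def by (auto simp: PiE_iff r_distr m_ac)
qed

definition rank_one :: "('a, 'v, 'm) module_scheme \<Rightarrow> ('v \<Rightarrow> 'a) \<times> 'v \<Rightarrow> 'v \<Rightarrow> 'v"
  where "rank_one V p = (\<lambda>y\<in>carrier V. fst p y \<odot>\<^bsub>V\<^esub> snd p)"

lemma rank_one_apply: "y \<in> carrier V \<Longrightarrow> rank_one V p y = fst p y \<odot>\<^bsub>V\<^esub> snd p"
  by (simp add: rank_one_def)

lemma (in module) rank_one_closed:
  "p \<in> carrier (dual_module R M) \<times> carrier M \<Longrightarrow> rank_one M p \<in> carrier (End_algebra R M)"
  unfolding End_carrier rank_one_def
  by (auto simp: dual_linear smult_l_distr smult_assoc1)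

text \<open>This is the identity behind the multiplication rule of the composition algebra:
  applying \<open>l\<^sub>1(-) x\<^sub>1\<close> to \<open>l\<^sub>2(y) x\<^sub>2\<close> gives \<open>l\<^sub>2(y) l\<^sub>1(x\<^sub>2) x\<^sub>1\<close>.\<close>

lemma (in module) rank_one_mult:
  assumes "l\<^sub>1 \<in> carrier (dual_module R M)" "x\<^sub>1 \<in> carrier M"
    and "l\<^sub>2 \<in> carrier (dual_module R M)" "x\<^sub>2 \<in> carrier M"
  shows "rank_one M (l\<^sub>1, x\<^sub>1) \<otimes>\<^bsub>End_algebra R M\<^esub> rank_one M (l\<^sub>2, x\<^sub>2) =
    l\<^sub>1 x\<^sub>2 \<odot>\<^bsub>End_algebra R M\<^esub> rank_one M (l\<^sub>2, x\<^sub>1)"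
proof (rule End_eqI[where R = R and V = M])
  fix y assume "y \<in> carrier M"
  then show "(rank_one M (l\<^sub>1, x\<^sub>1) \<otimes>\<^bsub>End_algebra R M\<^esub> rank_one M (l\<^sub>2, x\<^sub>2)) y =
      (l\<^sub>1 x\<^sub>2 \<odot>\<^bsub>End_algebra R M\<^esub> rank_one M (l\<^sub>2, x\<^sub>1)) y"
    using assms by (simp add: End_apply rank_one_apply rank_one_closed R.dual_closed[OF module_axioms] dual_linear smult_assoc1 R.m_comm)
qed (use assms in \<open>simp_all add: End_closed rank_one_closed dual_linear\<close>)

text \<open>By the dual basis lemma, the modules with such a family are the finitely generated projective
  ones; over a field, a basis with its coordinate functionals is an instance.\<close>

locale dual_basis = module R V for R (structure) and V (structure) +
  fixes n :: nat and b :: "nat \<Rightarrow> 'c" and c :: "nat \<Rightarrow> 'c \<Rightarrow> 'a"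
  assumes b_closed: "i < n \<Longrightarrow> b i \<in> carrier V"
    and c_closed: "i < n \<Longrightarrow> c i \<in> carrier (dual_module R V)"
    and expansion: "x \<in> carrier V \<Longrightarrow> (\<Oplus>\<^bsub>V\<^esub>i\<in>{..<n}. c i x \<odot>\<^bsub>V\<^esub> b i) = x"
begin

abbreviation "D \<equiv> dual_module R V"
abbreviation "E \<equiv> End_algebra R V"
abbreviation "S \<equiv> carrier D \<times> carrier V"
abbreviation "T \<equiv> tensor_free R D V"
abbreviation "gen l x \<equiv> tensor_gen R D V l x"

sublocale E: assoc_algebra R E
  by (rule End_assoc_algebra)

sublocale T: module R T
  by (rule R.free_module_is_module)

lemma gen_closed: "gen l x \<in> carrier T"
  unfolding tensor_gen_def by (rule R.free_closed)

definition realize :: "(('c \<Rightarrow> 'a) \<times> 'c \<Rightarrow> 'a) \<Rightarrow> 'c \<Rightarrow> 'c"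
  where "realize = linear_extension R E S (rank_one V)"

lemma rank_one_Pi: "rank_one V \<in> S \<rightarrow> carrier E"
  using rank_one_closed by blast

lemma realize_closed: "f \<in> carrier T \<Longrightarrow> realize f \<in> carrier E"
  unfolding realize_def by (rule E.linear_extension_closed[OF rank_one_Pi])

lemma realize_add:
  "\<lbrakk>f \<in> carrier T; g \<in> carrier T\<rbrakk> \<Longrightarrow> realize (f \<oplus>\<^bsub>T\<^esub> g) = realize f \<oplus>\<^bsub>E\<^esub> realize g"
  unfolding realize_def by (rule E.linear_extension_add[OF rank_one_Pi])

lemma realize_smult:
  "\<lbrakk>a \<in> carrier R; f \<in> carrier T\<rbrakk> \<Longrightarrow> realize (a \<odot>\<^bsub>T\<^esub> f) = a \<odot>\<^bsub>E\<^esub> realize f"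
  unfolding realize_def by (rule E.linear_extension_smult[OF rank_one_Pi])

lemma realize_gen: "\<lbrakk>l \<in> carrier D; x \<in> carrier V\<rbrakk> \<Longrightarrow> realize (gen l x) = rank_one V (l, x)"
  unfolding realize_def tensor_gen_def by (rule E.linear_extension_gen[OF rank_one_Pi]) simp

lemma realize_zero: "realize \<zero>\<^bsub>T\<^esub> = \<zero>\<^bsub>E\<^esub>"
  using realize_smult[of \<zero> "\<zero>\<^bsub>T\<^esub>"] realize_closed[of "\<zero>\<^bsub>T\<^esub>"] by simp

lemma realize_minus:
  assumes "f \<in> carrier T" and "g \<in> carrier T"
  shows "realize (f \<ominus>\<^bsub>T\<^esub> g) = realize f \<ominus>\<^bsub>E\<^esub> realize g"
proof -
  have "\<ominus>\<^bsub>T\<^esub> g = (\<ominus> \<one>) \<odot>\<^bsub>T\<^esub> g"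
    using assms by (simp add: T.smult_l_minus)
  then have "realize (\<ominus>\<^bsub>T\<^esub> g) = \<ominus>\<^bsub>E\<^esub> realize g"
    using assms realize_closed by (simp add: realize_smult E.smult_l_minus)
  then show ?thesis
    using assms by (simp add: a_minus_def realize_add)
qed

lemma realize_finsum:
  "f \<in> I \<rightarrow> carrier T \<Longrightarrow> realize (\<Oplus>\<^bsub>T\<^esub>i\<in>I. f i) = (\<Oplus>\<^bsub>E\<^esub>i\<in>I. realize (f i))"
  by (rule finsum_additive[OF T.abelian_group_axioms E.is_abelian_group, where h = realize])
    (simp_all add: realize_closed realize_add)

text \<open>The next two definitions give a section of the realization: \<open>\<phi>\<close> is expanded in the
  \<open>b\<^sub>i\<close>, with the functionals \<open>c\<^sub>i \<circ> \<phi>\<close> as coefficients.\<close>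

definition coordinate :: "nat \<Rightarrow> ('c \<Rightarrow> 'c) \<Rightarrow> 'c \<Rightarrow> 'a"
  where "coordinate i \<phi> = (\<lambda>y\<in>carrier V. c i (\<phi> y))"

definition lift :: "('c \<Rightarrow> 'c) \<Rightarrow> ('c \<Rightarrow> 'a) \<times> 'c \<Rightarrow> 'a"
  where "lift \<phi> = (\<Oplus>\<^bsub>T\<^esub>i\<in>{..<n}. gen (coordinate i \<phi>) (b i))"

lemma coordinate_closed: "\<lbrakk>i < n; \<phi> \<in> carrier E\<rbrakk> \<Longrightarrow> coordinate i \<phi> \<in> carrier D"
  unfolding dual_carrier coordinate_def
  using c_closed[of i] by (auto simp: dual_linear End_linear End_apply_closed)

lemma coordinate_add:
  "\<lbrakk>i < n; \<phi> \<in> carrier E; \<psi> \<in> carrier E\<rbrakk> \<Longrightarrow>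
    coordinate i (\<phi> \<oplus>\<^bsub>E\<^esub> \<psi>) = coordinate i \<phi> \<oplus>\<^bsub>D\<^esub> coordinate i \<psi>"
  using dual_linear(1)[OF c_closed, of i]
  by (auto simp: coordinate_def dual_module_def End_apply End_apply_closed intro!: restrict_ext)

lemma coordinate_smult:
  "\<lbrakk>i < n; a \<in> carrier R; \<phi> \<in> carrier E\<rbrakk> \<Longrightarrow>
    coordinate i (a \<odot>\<^bsub>E\<^esub> \<phi>) = a \<odot>\<^bsub>D\<^esub> coordinate i \<phi>"
  using dual_linear(2)[OF c_closed, of i]
  by (auto simp: coordinate_def dual_module_def End_apply End_apply_closed intro!: restrict_ext)

lemma coordinate_rank_one:
  "\<lbrakk>i < n; l \<in> carrier D; x \<in> carrier V\<rbrakk> \<Longrightarrow>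
    coordinate i (rank_one V (l, x)) = c i x \<odot>\<^bsub>D\<^esub> l"
  using dual_linear(2,3)[OF c_closed, of i] dual_linear(3)[of l R V]
  by (auto simp: coordinate_def dual_module_def rank_one_def R.m_comm intro!: restrict_ext)

lemma lift_closed: "lift \<phi> \<in> carrier T"
  unfolding lift_def by (rule T.M.finsum_closed) (simp add: gen_closed)

lemma realize_lift:
  assumes \<phi>: "\<phi> \<in> carrier E"
  shows "realize (lift \<phi>) = \<phi>"
proof (rule End_eqI[where R = R and V = V])
  fix y assume y: "y \<in> carrier V"
  have "realize (lift \<phi>) = (\<Oplus>\<^bsub>E\<^esub>i\<in>{..<n}. realize (gen (coordinate i \<phi>) (b i)))"
    unfolding lift_def by (rule realize_finsum) (simp add: gen_closed)
  then have "realize (lift \<phi>) y = (\<Oplus>\<^bsub>V\<^esub>i\<in>{..<n}. realize (gen (coordinate i \<phi>) (b i)) y)"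
    using y by (simp add: End_finsum_apply realize_closed gen_closed)
  also have "\<dots> = (\<Oplus>\<^bsub>V\<^esub>i\<in>{..<n}. c i (\<phi> y) \<odot>\<^bsub>V\<^esub> b i)"
  proof (rule M.finsum_cong')
    fix i assume "i \<in> {..<n}"
    then show "realize (gen (coordinate i \<phi>) (b i)) y = c i (\<phi> y) \<odot>\<^bsub>V\<^esub> b i"
      using y \<phi> realize_gen[OF coordinate_closed b_closed]
      by (simp add: rank_one_apply coordinate_def)
  qed (use dual_linear(3)[OF c_closed] b_closed End_apply_closed[OF \<phi> y] in auto)
  also have "\<dots> = \<phi> y"
    using y \<phi> by (simp add: expansion End_apply_closed)
  finally show "realize (lift \<phi>) y = \<phi> y" .
qed (use \<phi> lift_closed realize_closed in auto)

text \<open>Evaluation \<open>l(y) x\<close> is bilinear in \<open>l\<close> and \<open>x\<close>, so each of the four kinds of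
  relations realizes the zero map.\<close>

lemma realize_relations:
  assumes "r \<in> tensor_relations R D V"
  shows "r \<in> carrier T" and "realize r = \<zero>\<^bsub>E\<^esub>"
proof -
  note [simp] = gen_closed R.dual_closed[OF module_axioms] realize_minus realize_add realize_smult
    realize_gen rank_one_closed
  have "r \<in> carrier T \<and> realize r = \<zero>\<^bsub>E\<^esub>"
    using assms unfolding tensor_relations_def Let_def
  proof (elim UnE CollectE exE conjE)
    fix v v' w assume "v \<in> carrier D" "v' \<in> carrier D" "w \<in> carrier V"
      "r = gen (v \<oplus>\<^bsub>D\<^esub> v') w \<ominus>\<^bsub>T\<^esub> (gen v w \<oplus>\<^bsub>T\<^esub> gen v' w)"
    moreover from this have "rank_one V (v \<oplus>\<^bsub>D\<^esub> v', w) = rank_one V (v, w) \<oplus>\<^bsub>E\<^esub> rank_one V (v', w)"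
      by (intro End_eqI[where R = R and V = V])
        (auto simp: End_closed End_apply rank_one_apply rank_one_closed R.dual_closed[OF module_axioms] dual_apply dual_linear smult_l_distr)
    ultimately show ?thesis by simp
  next
    fix v w w' assume "v \<in> carrier D" "w \<in> carrier V" "w' \<in> carrier V"
      "r = gen v (w \<oplus>\<^bsub>V\<^esub> w') \<ominus>\<^bsub>T\<^esub> (gen v w \<oplus>\<^bsub>T\<^esub> gen v w')"
    moreover from this have "rank_one V (v, w \<oplus>\<^bsub>V\<^esub> w') = rank_one V (v, w) \<oplus>\<^bsub>E\<^esub> rank_one V (v, w')"
      by (intro End_eqI[where R = R and V = V])
        (auto simp: End_closed End_apply rank_one_apply rank_one_closed R.dual_closed[OF module_axioms] dual_linear smult_r_distr)
    ultimately show ?thesis by simp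
  next
    fix a v w assume "a \<in> carrier R" "v \<in> carrier D" "w \<in> carrier V"
      "r = gen (a \<odot>\<^bsub>D\<^esub> v) w \<ominus>\<^bsub>T\<^esub> (a \<odot>\<^bsub>T\<^esub> gen v w)"
    moreover from this have "rank_one V (a \<odot>\<^bsub>D\<^esub> v, w) = a \<odot>\<^bsub>E\<^esub> rank_one V (v, w)"
      by (intro End_eqI[where R = R and V = V])
        (auto simp: End_closed End_apply rank_one_apply rank_one_closed R.dual_closed[OF module_axioms] dual_apply dual_linear smult_assoc1)
    ultimately show ?thesis by simp
  next
    fix a v w assume "a \<in> carrier R" "v \<in> carrier D" "w \<in> carrier V"
      "r = gen v (a \<odot>\<^bsub>V\<^esub> w) \<ominus>\<^bsub>T\<^esub> (a \<odot>\<^bsub>T\<^esub> gen v w)"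
    moreover from this have "rank_one V (v, a \<odot>\<^bsub>V\<^esub> w) = a \<odot>\<^bsub>E\<^esub> rank_one V (v, w)"
      by (intro End_eqI[where R = R and V = V])
        (auto simp: End_closed End_apply rank_one_apply rank_one_closed R.dual_closed[OF module_axioms] dual_linear smult_assoc1[symmetric] R.m_comm)
    ultimately show ?thesis by simp
  qed
  then show "r \<in> carrier T" and "realize r = \<zero>\<^bsub>E\<^esub>" by auto
qed

context
  fixes H
  assumes H: "submodule H R T" and relations: "tensor_relations R D V \<subseteq> H"
begin

abbreviation cong_H (infix \<open>\<approx>\<close> 50) where "cong_H \<equiv> T.congruent_mod H"

lemma gen_cong:
  "\<lbrakk>l \<in> carrier D; l' \<in> carrier D; x \<in> carrier V\<rbrakk> \<Longrightarrow> gen (l \<oplus>\<^bsub>D\<^esub> l') x \<approx> gen l x \<oplus>\<^bsub>T\<^esub> gen l' x"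
  "\<lbrakk>l \<in> carrier D; x \<in> carrier V; x' \<in> carrier V\<rbrakk> \<Longrightarrow> gen l (x \<oplus>\<^bsub>V\<^esub> x') \<approx> gen l x \<oplus>\<^bsub>T\<^esub> gen l x'"
  "\<lbrakk>a \<in> carrier R; l \<in> carrier D; x \<in> carrier V\<rbrakk> \<Longrightarrow> gen (a \<odot>\<^bsub>D\<^esub> l) x \<approx> a \<odot>\<^bsub>T\<^esub> gen l x"
  "\<lbrakk>a \<in> carrier R; l \<in> carrier D; x \<in> carrier V\<rbrakk> \<Longrightarrow> gen l (a \<odot>\<^bsub>V\<^esub> x) \<approx> a \<odot>\<^bsub>T\<^esub> gen l x"
proof -
  note [simp] = T.congruent_mod_def gen_closed
  have mem: "r \<in> H" if "r \<in> tensor_relations R D V" for r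
    using relations that by blast
  show "gen (l \<oplus>\<^bsub>D\<^esub> l') x \<approx> gen l x \<oplus>\<^bsub>T\<^esub> gen l' x"
    if "l \<in> carrier D" "l' \<in> carrier D" "x \<in> carrier V"
  proof -
    have "gen (l \<oplus>\<^bsub>D\<^esub> l') x \<ominus>\<^bsub>T\<^esub> (gen l x \<oplus>\<^bsub>T\<^esub> gen l' x) \<in> tensor_relations R D V"
      using that unfolding tensor_relations_def Let_def by blast
    then show ?thesis using mem by simp
  qed
  show "gen l (x \<oplus>\<^bsub>V\<^esub> x') \<approx> gen l x \<oplus>\<^bsub>T\<^esub> gen l x'"
    if "l \<in> carrier D" "x \<in> carrier V" "x' \<in> carrier V"
  proof -
    have "gen l (x \<oplus>\<^bsub>V\<^esub> x') \<ominus>\<^bsub>T\<^esub> (gen l x \<oplus>\<^bsub>T\<^esub> gen l x') \<in> tensor_relations R D V"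
      using that unfolding tensor_relations_def Let_def by blast
    then show ?thesis using mem by simp
  qed
  show "gen (a \<odot>\<^bsub>D\<^esub> l) x \<approx> a \<odot>\<^bsub>T\<^esub> gen l x"
    if "a \<in> carrier R" "l \<in> carrier D" "x \<in> carrier V"
  proof -
    have "gen (a \<odot>\<^bsub>D\<^esub> l) x \<ominus>\<^bsub>T\<^esub> (a \<odot>\<^bsub>T\<^esub> gen l x) \<in> tensor_relations R D V"
      using that unfolding tensor_relations_def Let_def by blast
    then show ?thesis using mem that by simp
  qed
  show "gen l (a \<odot>\<^bsub>V\<^esub> x) \<approx> a \<odot>\<^bsub>T\<^esub> gen l x"
    if "a \<in> carrier R" "l \<in> carrier D" "x \<in> carrier V"
  proof -
    have "gen l (a \<odot>\<^bsub>V\<^esub> x) \<ominus>\<^bsub>T\<^esub> (a \<odot>\<^bsub>T\<^esub> gen l x) \<in> tensor_relations R D V"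
      using that unfolding tensor_relations_def Let_def by blast
    then show ?thesis using mem that by simp
  qed
qed

lemma gen_finsum_cong:
  assumes l: "l \<in> carrier D" and f: "f \<in> I \<rightarrow> carrier V"
  shows "gen l (\<Oplus>\<^bsub>V\<^esub>i\<in>I. f i) \<approx> (\<Oplus>\<^bsub>T\<^esub>i\<in>I. gen l (f i))"
proof -
  have zero: "gen l \<zero>\<^bsub>V\<^esub> \<approx> \<zero>\<^bsub>T\<^esub>"
    using gen_cong(4)[of \<zero> l "\<zero>\<^bsub>V\<^esub>"] l by (simp add: gen_closed)
  show ?thesis
    using f
  proof (induction I rule: infinite_finite_induct)
    case (insert i I)
    have fi: "f i \<in> carrier V" "f \<in> I \<rightarrow> carrier V"
      using insert.prems by auto
    have "gen l (f i \<oplus>\<^bsub>V\<^esub> (\<Oplus>\<^bsub>V\<^esub>i\<in>I. f i)) \<approx> gen l (f i) \<oplus>\<^bsub>T\<^esub> gen l (\<Oplus>\<^bsub>V\<^esub>i\<in>I. f i)"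
      using l fi by (intro gen_cong) auto
    moreover have "gen l (f i) \<oplus>\<^bsub>T\<^esub> gen l (\<Oplus>\<^bsub>V\<^esub>i\<in>I. f i) \<approx> gen l (f i) \<oplus>\<^bsub>T\<^esub> (\<Oplus>\<^bsub>T\<^esub>i\<in>I. gen l (f i))"
      using insert.IH[OF fi(2)]
      by (intro T.congruent_mod_add[OF H] T.congruent_mod_refl[OF H] gen_closed)
    ultimately show ?case
      using T.congruent_mod_trans[OF H] insert.hyps fi by (simp add: gen_closed)
  qed (simp_all add: zero)
qed

lemma lift_add_cong:
  assumes "\<phi> \<in> carrier E" and "\<psi> \<in> carrier E"
  shows "lift (\<phi> \<oplus>\<^bsub>E\<^esub> \<psi>) \<approx> lift \<phi> \<oplus>\<^bsub>T\<^esub> lift \<psi>"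
proof -
  have "lift (\<phi> \<oplus>\<^bsub>E\<^esub> \<psi>) \<approx>
      (\<Oplus>\<^bsub>T\<^esub>i\<in>{..<n}. gen (coordinate i \<phi>) (b i) \<oplus>\<^bsub>T\<^esub> gen (coordinate i \<psi>) (b i))"
    unfolding lift_def
    by (rule T.congruent_mod_finsum[OF H])
      (use assms gen_cong(1) in \<open>auto simp: coordinate_add coordinate_closed b_closed\<close>)
  then show ?thesis
    by (simp add: lift_def T.M.finsum_addf gen_closed)
qed

lemma lift_smult_cong:
  assumes "a \<in> carrier R" and "\<phi> \<in> carrier E"
  shows "lift (a \<odot>\<^bsub>E\<^esub> \<phi>) \<approx> a \<odot>\<^bsub>T\<^esub> lift \<phi>"
proof -
  have "lift (a \<odot>\<^bsub>E\<^esub> \<phi>) \<approx> (\<Oplus>\<^bsub>T\<^esub>i\<in>{..<n}. a \<odot>\<^bsub>T\<^esub> gen (coordinate i \<phi>) (b i))"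
    unfolding lift_def
    by (rule T.congruent_mod_finsum[OF H])
      (use assms gen_cong(3) in \<open>auto simp: coordinate_smult coordinate_closed b_closed\<close>)
  then show ?thesis
    using assms by (simp add: lift_def T.finsum_smult_ldistr gen_closed)
qed

text \<open>The heart of injectivity. Scalars move across the tensor sign, so that
  \<open>\<Sum>\<^sub>i c\<^sub>i(x) l \<otimes> b\<^sub>i\<close> becomes \<open>l \<otimes> \<Sum>\<^sub>i c\<^sub>i(x) b\<^sub>i = l \<otimes> x\<close>.\<close>

lemma lift_rank_one_cong:
  assumes l: "l \<in> carrier D" and x: "x \<in> carrier V"
  shows "lift (rank_one V (l, x)) \<approx> gen l x"
proof -
  have scalar: "c i x \<in> carrier R" if "i < n" for i
    using dual_linear(3)[OF c_closed] that x by blast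
  have "lift (rank_one V (l, x)) \<approx> (\<Oplus>\<^bsub>T\<^esub>i\<in>{..<n}. gen l (c i x \<odot>\<^bsub>V\<^esub> b i))"
    unfolding lift_def
  proof (rule T.congruent_mod_finsum[OF H])
    fix i assume "i \<in> {..<n}"
    then have i: "i < n" by simp
    have "gen (c i x \<odot>\<^bsub>D\<^esub> l) (b i) \<approx> c i x \<odot>\<^bsub>T\<^esub> gen l (b i)"
      using i l b_closed scalar by (intro gen_cong) auto
    moreover have "gen l (c i x \<odot>\<^bsub>V\<^esub> b i) \<approx> c i x \<odot>\<^bsub>T\<^esub> gen l (b i)"
      using i l b_closed scalar by (intro gen_cong) auto
    ultimately have "gen (c i x \<odot>\<^bsub>D\<^esub> l) (b i) \<approx> gen l (c i x \<odot>\<^bsub>V\<^esub> b i)"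
      using T.congruent_mod_trans[OF H] T.congruent_mod_sym[OF H] by blast
    then show "gen (coordinate i (rank_one V (l, x))) (b i) \<approx> gen l (c i x \<odot>\<^bsub>V\<^esub> b i)"
      using i l x by (simp add: coordinate_rank_one)
  qed
  moreover have "gen l x \<approx> (\<Oplus>\<^bsub>T\<^esub>i\<in>{..<n}. gen l (c i x \<odot>\<^bsub>V\<^esub> b i))"
    using gen_finsum_cong[OF l, of "\<lambda>i. c i x \<odot>\<^bsub>V\<^esub> b i" "{..<n}"] expansion[OF x] scalar b_closed
    by (auto simp: Pi_iff)
  ultimately show ?thesis
    using T.congruent_mod_trans[OF H] T.congruent_mod_sym[OF H] by blast
qed

text \<open>Both sides are linear in \<open>f\<close> modulo the submodule, so it is enough to compare them on
  generators. As \<open>H\<close> is arbitrary among the submodules that contain the relations, the kernel of the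
  realization lies in the least of them.\<close>

lemma lift_realize_cong:
  assumes "f \<in> carrier T"
  shows "lift (realize f) \<approx> f"
  using assms
proof (induction rule: R.free_module_induct)
  case zero
  show ?case
    using lift_smult_cong[of \<zero> "\<zero>\<^bsub>E\<^esub>"] by (simp add: realize_zero lift_closed)
next
  case (gen a s)
  then obtain l x where s: "s = (l, x)" "l \<in> carrier D" "x \<in> carrier V" by auto
  have a: "a \<in> carrier R" by fact
  have "lift (a \<odot>\<^bsub>E\<^esub> rank_one V (l, x)) \<approx> a \<odot>\<^bsub>T\<^esub> lift (rank_one V (l, x))"
    using a s by (intro lift_smult_cong rank_one_closed) auto
  moreover have "a \<odot>\<^bsub>T\<^esub> lift (rank_one V (l, x)) \<approx> a \<odot>\<^bsub>T\<^esub> gen l x"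
    using a s by (intro T.congruent_mod_smult[OF H] lift_rank_one_cong)
  ultimately have "lift (a \<odot>\<^bsub>E\<^esub> rank_one V (l, x)) \<approx> a \<odot>\<^bsub>T\<^esub> gen l x"
    by (rule T.congruent_mod_trans[OF H])
  then show ?case
    using a s realize_smult[OF a gen_closed[of l x]] realize_gen[of l x]
    by (simp add: tensor_gen_def)
next
  case (add f g)
  have "lift (realize f \<oplus>\<^bsub>E\<^esub> realize g) \<approx> lift (realize f) \<oplus>\<^bsub>T\<^esub> lift (realize g)"
    using add by (intro lift_add_cong realize_closed)
  moreover have "lift (realize f) \<oplus>\<^bsub>T\<^esub> lift (realize g) \<approx> f \<oplus>\<^bsub>T\<^esub> g"
    using add by (intro T.congruent_mod_add[OF H])
  ultimately show ?case
    using T.congruent_mod_trans[OF H] add by (simp add: realize_add)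
qed

lemma realize_kernel_subset:
  assumes "f \<in> carrier T" and "realize f = \<zero>\<^bsub>E\<^esub>"
  shows "f \<in> H"
proof -
  have "lift (realize f) \<approx> \<zero>\<^bsub>T\<^esub>"
    using lift_smult_cong[of \<zero> "\<zero>\<^bsub>E\<^esub>"] assms(2) by (simp add: lift_closed)
  then have "f \<approx> \<zero>\<^bsub>T\<^esub>"
    using lift_realize_cong[OF assms(1)] T.congruent_mod_trans[OF H] T.congruent_mod_sym[OF H]
    by blast
  then show ?thesis
    using assms(1) T.M.minus_equality[of "\<zero>\<^bsub>T\<^esub>" "\<zero>\<^bsub>T\<^esub>"]
    by (simp add: T.congruent_mod_def a_minus_def)
qed

end

lemma tensor_kernel_eq: "tensor_kernel R D V = {f \<in> carrier T. realize f = \<zero>\<^bsub>E\<^esub>}" (is "_ = ?N")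
  and tensor_kernel_submodule: "submodule (tensor_kernel R D V) R T"
proof -
  have N: "submodule ?N R T"
  proof (rule T.submoduleI)
    fix f assume "f \<in> ?N"
    then show "\<ominus>\<^bsub>T\<^esub> f \<in> ?N"
      using realize_minus[of "\<zero>\<^bsub>T\<^esub>" f] by (simp add: a_minus_def realize_zero)
  qed (auto simp: realize_zero realize_add realize_smult)
  moreover have "tensor_relations R D V \<subseteq> ?N"
    using realize_relations by auto
  ultimately have "tensor_kernel R D V \<subseteq> ?N"
    unfolding tensor_kernel_def by blast
  moreover have "?N \<subseteq> tensor_kernel R D V"
    unfolding tensor_kernel_def using realize_kernel_subset by auto
  ultimately show eq: "tensor_kernel R D V = ?N"
    by blast
  show "submodule (tensor_kernel R D V) R T"
    unfolding eq by (rule N)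
qed

lemma realize_composition:
  assumes f: "f \<in> carrier T" and g: "g \<in> carrier T"
  shows "composition_free_mult R V f g \<in> carrier T"
    and "realize (composition_free_mult R V f g) = realize f \<otimes>\<^bsub>E\<^esub> realize g"
proof -
  let ?A = "{s \<in> S. f s \<noteq> \<zero>}" and ?B = "{s \<in> S. g s \<noteq> \<zero>}"
  let ?h = "\<lambda>p. (f (fst p) \<otimes> g (snd p) \<otimes> fst (fst p) (snd (snd p))) \<odot>\<^bsub>T\<^esub>
    gen (fst (snd p)) (snd (fst p))"
  have mult: "composition_free_mult R V f g = (\<Oplus>\<^bsub>T\<^esub>p\<in>?A \<times> ?B. ?h p)"
    unfolding composition_free_mult_def Let_def by (simp add: case_prod_unfold)
  have scalar: "f s \<in> carrier R" "g s \<in> carrier R" if "s \<in> S" for s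
    using that free_apply_closed f g by metis+
  have h: "?h p \<in> carrier T" and realize_h: "realize (?h p) =
      (f (fst p) \<odot>\<^bsub>E\<^esub> rank_one V (fst p)) \<otimes>\<^bsub>E\<^esub> (g (snd p) \<odot>\<^bsub>E\<^esub> rank_one V (snd p))"
    if "p \<in> ?A \<times> ?B" for p
  proof -
    obtain l\<^sub>1 x\<^sub>1 l\<^sub>2 x\<^sub>2 where p: "p = ((l\<^sub>1, x\<^sub>1), (l\<^sub>2, x\<^sub>2))"
      by (metis surj_pair)
    have lx: "l\<^sub>1 \<in> carrier D" "x\<^sub>1 \<in> carrier V" "l\<^sub>2 \<in> carrier D" "x\<^sub>2 \<in> carrier V"
      using that p by auto
    have r: "rank_one V (l\<^sub>1, x\<^sub>1) \<in> carrier E" "rank_one V (l\<^sub>2, x\<^sub>2) \<in> carrier E"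
        "rank_one V (l\<^sub>2, x\<^sub>1) \<in> carrier E" "l\<^sub>1 x\<^sub>2 \<in> carrier R"
        "f (l\<^sub>1, x\<^sub>1) \<in> carrier R" "g (l\<^sub>2, x\<^sub>2) \<in> carrier R"
      using lx by (auto simp: rank_one_closed dual_linear scalar)
    show "?h p \<in> carrier T"
      using r by (simp add: p gen_closed)
    show "realize (?h p) =
        (f (fst p) \<odot>\<^bsub>E\<^esub> rank_one V (fst p)) \<otimes>\<^bsub>E\<^esub> (g (snd p) \<odot>\<^bsub>E\<^esub> rank_one V (snd p))"
      using r lx
      by (simp add: p gen_closed realize_smult realize_gen E.smult_mult_left E.smult_mult_right
          rank_one_mult E.smult_assoc1[symmetric] R.m_ac)
  qed
  show "composition_free_mult R V f g \<in> carrier T"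
    unfolding mult by (intro T.M.finsum_closed Pi_I h)
  have "realize (composition_free_mult R V f g) = (\<Oplus>\<^bsub>E\<^esub>p\<in>?A \<times> ?B. realize (?h p))"
    unfolding mult by (intro realize_finsum Pi_I h)
  also have "\<dots> = (\<Oplus>\<^bsub>E\<^esub>p\<in>?A \<times> ?B.
      (f (fst p) \<odot>\<^bsub>E\<^esub> rank_one V (fst p)) \<otimes>\<^bsub>E\<^esub> (g (snd p) \<odot>\<^bsub>E\<^esub> rank_one V (snd p)))"
    by (rule E.finsum_cong'[OF refl _ realize_h])
      (use rank_one_closed scalar in \<open>auto intro!: E.m_closed E.smult_closed\<close>)
  also have "\<dots> = realize f \<otimes>\<^bsub>E\<^esub> realize g"
    unfolding realize_def linear_extension_def
    by (rule E.finsum_mult_finsum[symmetric])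
      (use rank_one_closed scalar free_support_finite[OF f] free_support_finite[OF g] in
        \<open>auto intro!: E.smult_closed\<close>)
  finally show "realize (composition_free_mult R V f g) = realize f \<otimes>\<^bsub>E\<^esub> realize g" .
qed

lemma composition_presentation:
  "algebra_presentation R E (tensor_kernel R D V) T realize (composition_free_mult R V)"
proof -
  have N: "abelian_subgroup (tensor_kernel R D V) T"
    by (rule abelian_subgroupI3[OF additive_subgroupI T.abelian_group_axioms])
      (rule submodule.axioms(1)[OF tensor_kernel_submodule])
  show ?thesis
  proof (rule algebra_presentation.intro[OF E.assoc_algebra_axioms N
        algebra_presentation_axioms.intro])
    fix f assume f: "f \<in> carrier T"
    have "h \<in> tensor_kernel R D V +>\<^bsub>T\<^esub> f \<longleftrightarrow> realize h = realize f" if h: "h \<in> carrier T" for h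
    proof -
      have "h \<in> tensor_kernel R D V +>\<^bsub>T\<^esub> f \<longleftrightarrow> realize (h \<ominus>\<^bsub>T\<^esub> f) = \<zero>\<^bsub>E\<^esub>"
        using abelian_subgroup.a_rcos_module[OF N f h] f h by (simp add: tensor_kernel_eq a_minus_def)
      then show ?thesis
        using f h by (simp add: realize_minus realize_closed)
    qed
    moreover have "tensor_kernel R D V +>\<^bsub>T\<^esub> f \<subseteq> carrier T"
      using T.M.a_r_coset_subset_G[OF T.submoduleE(1)[OF tensor_kernel_submodule] f] .
    ultimately show "tensor_kernel R D V +>\<^bsub>T\<^esub> f = {h \<in> carrier T. realize h = realize f}"
      by blast
  next
    fix \<phi> assume "\<phi> \<in> carrier E"
    then show "\<exists>f\<in>carrier T. realize f = \<phi>"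
      using realize_lift lift_closed by blast
  qed (simp_all add: realize_zero realize_add realize_smult realize_composition)
qed

text \<open>The unit of the composition algebra is specified by its defining property. It is the fibre over
  the identity map because a two-sided unit of a ring is unique.\<close>

lemma composition_algebra_eq: "composition_algebra R V =
    algebra_presentation.coset_algebra E (tensor_kernel R D V) T realize (composition_free_mult R V)"
  (is "_ = ?A")
proof -
  note coset_algebra_def = algebra_presentation.coset_algebra_def[OF composition_presentation]
  interpret A: assoc_algebra R ?A
    by (rule algebra_presentation.coset_algebra_assoc[OF composition_presentation])
  have carrier: "carrier (tensor_module R D V) = carrier ?A"
    by (auto simp: tensor_module_def Let_def coset_algebra_def A_RCOSETS_def' realize_closed)
  have mult: "composition_mult R V = monoid.mult ?A"
    by (simp add: fun_eq_iff composition_mult_def coset_algebra_def)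
  have "(THE e. e \<in> carrier ?A \<and> (\<forall>a\<in>carrier ?A. e \<otimes>\<^bsub>?A\<^esub> a = a \<and> a \<otimes>\<^bsub>?A\<^esub> e = a)) = \<one>\<^bsub>?A\<^esub>"
  proof (rule the_equality)
    fix e assume e: "e \<in> carrier ?A \<and> (\<forall>a\<in>carrier ?A. e \<otimes>\<^bsub>?A\<^esub> a = a \<and> a \<otimes>\<^bsub>?A\<^esub> e = a)"
    then have "e = e \<otimes>\<^bsub>?A\<^esub> \<one>\<^bsub>?A\<^esub>"
      by (simp add: A.r_one)
    also have "\<dots> = \<one>\<^bsub>?A\<^esub>"
      using e A.one_closed by blast
    finally show "e = \<one>\<^bsub>?A\<^esub>" .
  qed simp
  then have "composition_algebra R V =
      tensor_module R D V\<lparr>monoid.mult := monoid.mult ?A, one := \<one>\<^bsub>?A\<^esub>\<rparr>"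
    unfolding composition_algebra_def Let_def mult carrier by simp
  also have "\<dots> = ?A"
    using carrier by (simp add: tensor_module_def Let_def coset_algebra_def)
  finally show ?thesis .
qed

lemma composition_algebra_assoc: "assoc_algebra R (composition_algebra R V)"
  unfolding composition_algebra_eq
  by (rule algebra_presentation.coset_algebra_assoc[OF composition_presentation])

lemma composition_algebra_iso:
  "algebra_presentation.fibre T realize \<in> algebra_iso R E (composition_algebra R V)"
  unfolding composition_algebra_eq
  by (rule algebra_presentation.fibre_iso[OF composition_presentation])

end


section \<open>Frobenius maps\<close>

text \<open>Lagrange in the multiplicative group; the element zero is treated apart.\<close>

lemma (in field) pow_card_eq_self:
  assumes "finite (carrier R)" and x: "x \<in> carrier R"
  shows "x [^] card (carrier R) = x"
proof (cases "x = \<zero>")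
  case True
  have "card (carrier R) \<noteq> 0"
    using assms by auto
  then show ?thesis
    using True by (simp add: nat_pow_zero)
next
  case False
  have card: "card (carrier R) = Suc (order (mult_of R))"
    using assms by (simp add: order_mult_of order_def card_gt_0_iff)
      (metis Suc_pred card_gt_0_iff empty_iff)
  have "x [^] order (mult_of R) = \<one>"
    using group.pow_order_eq_1[OF field_mult_group, of x] x False by (simp add: nat_pow_mult_of)
  then show ?thesis
    using x unfolding card by simp
qed

lemma (in UP_domain) few_roots_imp_zero:
  assumes "finite (carrier R)" and f: "f \<in> carrier P"
    and A: "A \<subseteq> carrier R" "\<And>x. x \<in> A \<Longrightarrow> eval R R id x f = \<zero>"
    and coeff: "\<And>k. card A \<le> k \<Longrightarrow> coeff P f k = \<zero>"
  shows "f = \<zero>\<^bsub>P\<^esub>"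
proof (rule ccontr)
  assume nonzero: "f \<noteq> \<zero>\<^bsub>P\<^esub>"
  then have "lcoeff f \<noteq> \<zero>"
    using f by (rule lcoeff_nonzero)
  then have "deg R f < card A"
    using coeff not_less by blast
  moreover have "card A \<le> card {a \<in> carrier R. eval R R id a f = \<zero>}"
    using assms(1) A by (intro card_mono) auto
  ultimately show False
    using roots_bound[OF f nonzero assms(1)] by simp
qed

locale finite_extension = field K for K (structure) +
  fixes F :: "'a set" and q n :: nat
  assumes subfield: "subfield F K" and card_F: "card F = q" and q_gt_1: "1 < q"
    and card_K: "card (carrier K) = q ^ n"
begin

sublocale Poly: UP_domain K "UP K"
  by unfold_locales

abbreviation "P \<equiv> UP K"
abbreviation "ev x f \<equiv> eval K K id x f"

text \<open>An infinite carrier would have cardinality 0, which is no power of a number above 1.\<close>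

lemma finite_K: "finite (carrier K)"
  using card_K q_gt_1 by (metis card.infinite not_one_less_zero power_not_zero zero_neq_one not_gr0)

lemma F_subset: "F \<subseteq> carrier K"
  using subfieldE(3)[OF subfield] .

lemma F_pow: "c \<in> F \<Longrightarrow> c [^] q = c"
  using field.pow_card_eq_self[OF subfield_iff(2)[OF subfield], of c] F_subset finite_K card_F
  by (simp add: nat_pow_consistent[symmetric] finite_subset)

lemma K_pow: "x \<in> carrier K \<Longrightarrow> x [^] (q ^ n) = x"
  using pow_card_eq_self[OF finite_K] card_K by simp

lemma ev_finsum:
  assumes "f \<in> I \<rightarrow> carrier P" and "x \<in> carrier K"
  shows "ev x (\<Oplus>\<^bsub>P\<^esub>i\<in>I. f i) = (\<Oplus>i\<in>I. ev x (f i))"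
  by (rule finsum_additive[OF Poly.P.abelian_group_axioms abelian_group_axioms, where h = "ev x"])
    (use assms in \<open>simp_all add: Poly.evalRR_simps\<close>)

text \<open>The terms of the binomial expansion below the leading one form a single polynomial, the same
  for all \<open>z\<close>, and so become accessible to root counting.\<close>

lemma pow_add_one:
  "\<exists>r\<in>carrier P. (\<forall>k\<ge>m. coeff P r k = \<zero>) \<and>
    (\<forall>z\<in>carrier K. (z \<oplus> \<one>) [^] m = z [^] m \<oplus> ev z r)"
proof (induction m)
  case 0
  show ?case
    by (rule bexI[of _ "\<zero>\<^bsub>P\<^esub>"]) (use Poly.evalRR_monom[of \<zero> _ 0] in \<open>simp_all add: id_def\<close>)
next
  case (Suc m)
  then obtain r where r: "r \<in> carrier P" "\<And>k. m \<le> k \<Longrightarrow> coeff P r k = \<zero>"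
    "\<And>z. z \<in> carrier K \<Longrightarrow> (z \<oplus> \<one>) [^] m = z [^] m \<oplus> ev z r" by blast
  let ?s = "monom P \<one> m \<oplus>\<^bsub>P\<^esub> (monom P \<one> 1 \<otimes>\<^bsub>P\<^esub> r \<oplus>\<^bsub>P\<^esub> r)"
  have coeff_s: "coeff P ?s k = \<zero>" if "Suc m \<le> k" for k
  proof -
    define j where "j = k - 1"
    have j: "k = j + 1" "m \<le> j" using that by (auto simp: j_def)
    have "coeff P (monom P \<one> 1 \<otimes>\<^bsub>P\<^esub> r) k = \<zero>"
      using Poly.coeff_monom_mult[OF one_closed r(1), of 1 j] r(2)[OF j(2)] j(1) by simp
    then show ?thesis
      using r(1,2) that by simp
  qed
  have pow_s: "(z \<oplus> \<one>) [^] Suc m = z [^] Suc m \<oplus> ev z ?s" if z: "z \<in> carrier K" for z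
  proof -
    have e: "ev z r \<in> carrier K" "z [^] m \<in> carrier K"
      using z r by (simp_all add: Poly.evalRR_simps)
    have ev_s: "ev z ?s = z [^] m \<oplus> (z \<otimes> ev z r \<oplus> ev z r)"
      using z r(1) by (simp add: Poly.evalRR_simps)
    have expand: "(u \<oplus> v) \<otimes> (z \<oplus> \<one>) = u \<otimes> z \<oplus> (u \<oplus> (z \<otimes> v \<oplus> v))"
      if "u \<in> carrier K" "v \<in> carrier K" for u v
      using that z by algebra
    show ?thesis
      unfolding nat_pow_Suc r(3)[OF z] ev_s by (rule expand[OF e(2,1)])
  qed
  show ?case
  proof (intro bexI[of _ ?s] conjI allI impI ballI coeff_s pow_s)
    show "?s \<in> carrier P" using r(1) by simp
  qed
qed

text \<open>A root count takes the place of the divisibility of binomial coefficients: the polynomial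
  \<open>(x + 1)\<^sup>q - x\<^sup>q - 1\<close> has degree below \<open>q\<close> and vanishes at the \<open>q\<close> elements of \<open>F\<close>, on
  which \<open>x \<mapsto> x\<^sup>q\<close> is the identity; so it is the zero polynomial, and the identity holds on all of
  \<open>K\<close>.\<close>

lemma frobenius_add_one:
  assumes z: "z \<in> carrier K"
  shows "(z \<oplus> \<one>) [^] q = z [^] q \<oplus> \<one>"
proof -
  obtain r where r: "r \<in> carrier P" "\<And>k. q \<le> k \<Longrightarrow> coeff P r k = \<zero>"
    "\<And>z. z \<in> carrier K \<Longrightarrow> (z \<oplus> \<one>) [^] q = z [^] q \<oplus> ev z r"
    using pow_add_one[of q] by blast
  have "r \<ominus>\<^bsub>P\<^esub> \<one>\<^bsub>P\<^esub> = \<zero>\<^bsub>P\<^esub>"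
  proof (rule Poly.few_roots_imp_zero[OF finite_K _ F_subset])
    show "r \<ominus>\<^bsub>P\<^esub> \<one>\<^bsub>P\<^esub> \<in> carrier P" using r by simp
    show "coeff P (r \<ominus>\<^bsub>P\<^esub> \<one>\<^bsub>P\<^esub>) k = \<zero>" if "card F \<le> k" for k
      using that r q_gt_1 by (simp add: card_F Poly.coeff_minus)
    fix c assume c: "c \<in> F"
    then have cK: "c \<in> carrier K" using F_subset by blast
    have c1: "c \<oplus> \<one> \<in> F"
      using c subfieldE(1)[OF subfield] subringE(3,7) by metis
    have e: "ev c r \<in> carrier K" using cK r by (simp add: Poly.evalRR_simps)
    have "c \<oplus> \<one> = c \<oplus> ev c r"
      using r(3)[OF cK] F_pow[OF c] F_pow[OF c1] by simp
    then have "ev c r = \<one>"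
      using cK e by simp
    then show "ev c (r \<ominus>\<^bsub>P\<^esub> \<one>\<^bsub>P\<^esub>) = \<zero>"
      using cK r by (simp add: Poly.evalRR_simps)
  qed
  then have "r = \<one>\<^bsub>P\<^esub>" using r by simp
  then show ?thesis
    using r(3)[OF z] z by (simp add: Poly.evalRR_simps)
qed

text \<open>By homogeneity, \<open>(x + y)\<^sup>q = (x/y + 1)\<^sup>q y\<^sup>q\<close>.\<close>

lemma frobenius_add:
  assumes x: "x \<in> carrier K" and y: "y \<in> carrier K"
  shows "(x \<oplus> y) [^] q = x [^] q \<oplus> y [^] q"
proof (cases "y = \<zero>")
  case True
  then show ?thesis
    using x q_gt_1 by (simp add: nat_pow_zero)
next
  case False
  then have yu: "y \<in> Units K" using y by (simp add: field_Units)
  let ?z = "x \<otimes> inv y"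
  have z: "?z \<in> carrier K" using x yu by simp
  have xz: "?z \<otimes> y = x"
    using x yu y by (simp add: m_assoc)
  have "x \<oplus> y = (?z \<oplus> \<one>) \<otimes> y"
    using z y xz by (simp add: l_distr)
  then have "(x \<oplus> y) [^] q = (?z [^] q \<oplus> \<one>) \<otimes> y [^] q"
    using z y by (simp add: nat_pow_distrib frobenius_add_one)
  also have "\<dots> = (?z \<otimes> y) [^] q \<oplus> y [^] q"
    using z y by (simp add: nat_pow_distrib l_distr)
  finally show ?thesis using xz by simp
qed

lemma frobenius_power_add:
  assumes "x \<in> carrier K" and "y \<in> carrier K"
  shows "(x \<oplus> y) [^] (q ^ i) = x [^] (q ^ i) \<oplus> y [^] (q ^ i)"
proof (induction i)
  case (Suc i)
  have *: "u [^] (q ^ Suc i) = (u [^] (q ^ i)) [^] q" if "u \<in> carrier K" for u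
    using that by (simp add: nat_pow_pow mult.commute)
  show ?case
    using assms Suc * by (simp add: frobenius_add del: power_Suc)
qed (use assms in simp)

lemma frobenius_power_F:
  assumes "c \<in> F"
  shows "c [^] (q ^ i) = c"
proof (induction i)
  case (Suc i)
  have "c [^] (q ^ Suc i) = (c [^] (q ^ i)) [^] q"
    using assms F_subset by (auto simp: nat_pow_pow mult.commute)
  then show ?case
    using Suc F_pow[OF assms] by simp
qed (use assms F_subset in auto)


section \<open>Bases of the extension\<close>

text \<open>The span of \<open>k < n\<close> vectors has at most \<open>q\<^sup>k < q\<^sup>n\<close> elements, so some vector of \<open>K\<close> lies
  outside it and can be added to the family.\<close>

lemma independent_family:
  "k \<le> n \<Longrightarrow> \<exists>b\<in>{..<k} \<rightarrow> carrier K. \<forall>a\<in>{..<k} \<rightarrow> F.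
    (\<Oplus>i\<in>{..<k}. a i \<otimes> b i) = \<zero> \<longrightarrow> (\<forall>i<k. a i = \<zero>)"
proof (induction k)
  case (Suc k)
  note F_closed = subringE[OF subfieldE(1)[OF subfield]]
  obtain b where b: "b \<in> {..<k} \<rightarrow> carrier K"
    and indep: "\<And>a. \<lbrakk>a \<in> {..<k} \<rightarrow> F; (\<Oplus>i\<in>{..<k}. a i \<otimes> b i) = \<zero>\<rbrakk> \<Longrightarrow> \<forall>i<k. a i = \<zero>"
    using Suc by (metis Suc_leD)
  let ?span = "(\<lambda>a. \<Oplus>i\<in>{..<k}. a i \<otimes> b i) ` ({..<k} \<rightarrow>\<^sub>E F)"
  have F_fin: "finite F"
    using F_subset finite_K finite_subset by blast
  have "card ?span \<le> card ({..<k} \<rightarrow>\<^sub>E F)"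
    by (rule card_image_le) (use F_fin in \<open>simp add: finite_PiE\<close>)
  also have "\<dots> = q ^ k"
    by (simp add: card_PiE card_F)
  also have "\<dots> < card (carrier K)"
    using Suc.prems q_gt_1 card_K by simp
  finally have "\<not> carrier K \<subseteq> ?span"
    using card_mono[of ?span "carrier K"] F_fin by (auto simp: finite_PiE)
  then obtain y where y: "y \<in> carrier K" "y \<notin> ?span" by blast
  let ?b = "b(k := y)"
  have "\<forall>i<Suc k. a i = \<zero>" if a: "a \<in> {..<Suc k} \<rightarrow> F"
    and sum: "(\<Oplus>i\<in>{..<Suc k}. a i \<otimes> ?b i) = \<zero>" for a
  proof -
    have aF: "a \<in> {..<k} \<rightarrow> F" "a k \<in> F" and aK: "a k \<in> carrier K"
      and abK: "(\<lambda>i. a i \<otimes> b i) \<in> {..<k} \<rightarrow> carrier K"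
      using a b F_subset by (auto simp: Pi_iff subset_iff)
    let ?s = "\<Oplus>i\<in>{..<k}. a i \<otimes> b i"
    have s: "?s \<in> carrier K" using abK by (rule finsum_closed)
    have "(\<Oplus>i\<in>{..<k}. a i \<otimes> ?b i) = ?s"
      by (rule finsum_cong') (use abK in auto)
    moreover have "(\<lambda>i. a i \<otimes> ?b i) \<in> {..<k} \<rightarrow> carrier K"
      using abK by (auto simp: Pi_iff)
    ultimately have split: "a k \<otimes> y \<oplus> ?s = \<zero>"
      using sum aK y by (simp add: lessThan_Suc)
    have "a k = \<zero>"
    proof (rule ccontr)
      assume nz: "a k \<noteq> \<zero>"
      let ?c = "\<ominus> (inv (a k))"
      have inv: "inv (a k) \<in> F" "a k \<otimes> inv (a k) = \<one>"
        using subfield_m_inv[OF subfield, of "a k"] aF nz by auto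
      have invK: "inv (a k) \<in> carrier K" using inv F_subset by blast
      have c: "?c \<in> F" "?c \<in> carrier K" using inv invK F_closed(5) by auto
      \<comment> \<open>Solving the dependence for \<open>y\<close> puts it into the span of the other vectors.\<close>
      have "y = (a k \<otimes> inv (a k)) \<otimes> y" using inv y by simp
      also have "\<dots> = inv (a k) \<otimes> (a k \<otimes> y \<oplus> ?s) \<oplus> ?c \<otimes> ?s"
      proof -
        have "(v \<otimes> u) \<otimes> y = u \<otimes> (v \<otimes> y \<oplus> w) \<oplus> (\<ominus> u) \<otimes> w"
          if "u \<in> carrier K" "v \<in> carrier K" "w \<in> carrier K" for u v w
          using that y by algebra
        then show ?thesis using invK aK s by blast
      qed
      also have "\<dots> = ?c \<otimes> ?s" using split invK c s by simp
      also have "\<dots> = (\<Oplus>i\<in>{..<k}. ?c \<otimes> (a i \<otimes> b i))"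
        by (rule finsum_rdistr) (use c abK in auto)
      also have "\<dots> = (\<Oplus>i\<in>{..<k}. (\<lambda>i\<in>{..<k}. ?c \<otimes> a i) i \<otimes> b i)"
        by (rule finsum_cong')
          (use c aF b F_subset in \<open>auto simp: m_assoc Pi_iff subset_iff\<close>)
      finally have "y = (\<Oplus>i\<in>{..<k}. (\<lambda>i\<in>{..<k}. ?c \<otimes> a i) i \<otimes> b i)" .
      moreover have "(\<lambda>i\<in>{..<k}. ?c \<otimes> a i) \<in> {..<k} \<rightarrow>\<^sub>E F"
        unfolding restrict_PiE_iff using c aF F_closed(6) by auto
      ultimately have "y \<in> ?span"
        by (rule image_eqI)
      then show False using y by blast
    qed
    moreover have "?s = \<zero>"
      using split s y \<open>a k = \<zero>\<close> by simp
    ultimately show ?thesis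
      using indep[OF aF(1)] less_Suc_eq by auto
  qed
  moreover have "?b \<in> {..<Suc k} \<rightarrow> carrier K"
    using b y by (auto simp: Pi_iff less_Suc_eq)
  ultimately show ?case by blast
qed simp

abbreviation "R \<equiv> K\<lparr>carrier := F\<rparr>"
abbreviation "V \<equiv> ring_as_module K"
abbreviation "E \<equiv> End_algebra R V"

lemma V_simps [simp]:
  "carrier V = carrier K" "\<zero>\<^bsub>V\<^esub> = \<zero>" "x \<oplus>\<^bsub>V\<^esub> y = x \<oplus> y" "x \<odot>\<^bsub>V\<^esub> y = x \<otimes> y"
  "finsum V f A = finsum K f A"
  by (simp_all add: ring_as_module_def finsum_def finprod_def)

lemma V_module: "module R V"
proof (rule moduleI)
  show "cring R"
    using subfield_iff(2)[OF subfield] by (simp add: field_def domain_def)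
  show "abelian_group V"
    by (rule abelian_groupI) (auto simp: a_ac intro: l_neg)
qed (use F_subset in \<open>auto simp: l_distr r_distr m_assoc subset_iff\<close>)

sublocale V: module R V
  by (rule V_module)

lemma independent_family_inj:
  assumes b: "b \<in> {..<k} \<rightarrow> carrier K"
    and indep: "\<And>a. \<lbrakk>a \<in> {..<k} \<rightarrow> F; (\<Oplus>i\<in>{..<k}. a i \<otimes> b i) = \<zero>\<rbrakk> \<Longrightarrow> \<forall>i<k. a i = \<zero>"
  shows "inj_on (\<lambda>a. \<Oplus>i\<in>{..<k}. a i \<otimes> b i) ({..<k} \<rightarrow>\<^sub>E F)"
proof (rule inj_onI)
  fix a a' assume a: "a \<in> {..<k} \<rightarrow>\<^sub>E F" and a': "a' \<in> {..<k} \<rightarrow>\<^sub>E F"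
    and eq: "(\<Oplus>i\<in>{..<k}. a i \<otimes> b i) = (\<Oplus>i\<in>{..<k}. a' i \<otimes> b i)"
  note F_closed = subringE[OF subfieldE(1)[OF subfield]]
  have K: "b i \<in> carrier K" "a i \<in> carrier K" "a' i \<in> carrier K" if "i < k" for i
    using that a a' b F_subset by (auto simp: PiE_iff Pi_iff)
  let ?d = "\<lambda>i. a i \<ominus> a' i"
  have "(\<Oplus>i\<in>{..<k}. a i \<otimes> b i) = (\<Oplus>i\<in>{..<k}. ?d i \<otimes> b i \<oplus> a' i \<otimes> b i)"
  proof (rule finsum_cong')
    fix i assume "i \<in> {..<k}"
    then have "i < k" by simp
    note K[OF this]
    then show "a i \<otimes> b i = ?d i \<otimes> b i \<oplus> a' i \<otimes> b i" by algebra
  qed (use K in auto)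
  also have "\<dots> = (\<Oplus>i\<in>{..<k}. ?d i \<otimes> b i) \<oplus> (\<Oplus>i\<in>{..<k}. a' i \<otimes> b i)"
    by (rule finsum_addf) (use K in auto)
  finally have "(\<Oplus>i\<in>{..<k}. ?d i \<otimes> b i) = \<zero>"
    using eq K by (simp add: finsum_closed Pi_iff)
  moreover have "?d \<in> {..<k} \<rightarrow> F"
    using a a' F_closed(5,7) by (auto simp: PiE_iff a_minus_def)
  ultimately have "\<forall>i<k. ?d i = \<zero>"
    using indep by blast
  then have "a i = a' i" if "i < k" for i
    using that K by simp
  then show "a = a'"
    using a a' by (intro PiE_ext[of a "{..<k}" "\<lambda>_. F" a']) auto
qed

text \<open>For \<open>k = n\<close> the \<open>q\<^sup>n\<close> linear combinations of the independent family are distinct, hence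
  fill \<open>K\<close>; the coordinates with respect to it are then well defined and linear by uniqueness.\<close>

lemma dual_basis_exists: "\<exists>b c. dual_basis R V n b c"
proof -
  note F_closed = subringE[OF subfieldE(1)[OF subfield]]
  obtain b where b: "b \<in> {..<n} \<rightarrow> carrier K"
    and indep: "\<And>a. \<lbrakk>a \<in> {..<n} \<rightarrow> F; (\<Oplus>i\<in>{..<n}. a i \<otimes> b i) = \<zero>\<rbrakk> \<Longrightarrow> \<forall>i<n. a i = \<zero>"
    using independent_family[of n] by blast
  let ?comb = "\<lambda>a. \<Oplus>i\<in>{..<n}. a i \<otimes> b i"
  have comb_closed: "?comb a \<in> carrier K" if "a \<in> {..<n} \<rightarrow>\<^sub>E F" for a
    by (rule finsum_closed) (use that b F_subset in \<open>auto simp: PiE_iff\<close>)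
  have inj: "inj_on ?comb ({..<n} \<rightarrow>\<^sub>E F)"
    using b indep by (rule independent_family_inj)
  have "card (?comb ` ({..<n} \<rightarrow>\<^sub>E F)) = card (carrier K)"
    using card_image[OF inj] by (simp add: card_PiE card_F card_K)
  then have surj: "?comb ` ({..<n} \<rightarrow>\<^sub>E F) = carrier K"
    using comb_closed finite_K by (intro card_subset_eq) auto
  define coords where "coords = inv_into ({..<n} \<rightarrow>\<^sub>E F) ?comb"
  have coords: "coords x \<in> {..<n} \<rightarrow>\<^sub>E F" "?comb (coords x) = x" if "x \<in> carrier K" for x
  proof -
    have x: "x \<in> ?comb ` ({..<n} \<rightarrow>\<^sub>E F)" using that surj by simp
    show "coords x \<in> {..<n} \<rightarrow>\<^sub>E F"
      unfolding coords_def by (rule inv_into_into[OF x])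
    show "?comb (coords x) = x"
      unfolding coords_def by (rule f_inv_into_f[OF x])
  qed
  have coords_F: "coords x i \<in> F" if "x \<in> carrier K" "i < n" for x i
    using coords(1)[OF that(1)] that(2) by auto
  have coords_eqI: "coords x i = a i"
    if "x \<in> carrier K" "a \<in> {..<n} \<rightarrow>\<^sub>E F" "?comb a = x" "i < n" for x a i
    using inj_onD[OF inj _ coords(1) that(2)] coords(2) that by metis
  have bK: "b i \<in> carrier K" if "i < n" for i using b that by auto
  have coordsK: "coords x i \<in> carrier K" if "x \<in> carrier K" "i < n" for x i
    using coords_F[OF that] F_subset by blast
  have "dual_basis R V n b (\<lambda>i. \<lambda>x\<in>carrier K. coords x i)"
  proof (rule dual_basis.intro[OF V_module dual_basis_axioms.intro])
    fix i assume i: "i < n"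
    show "b i \<in> carrier V" using b i by auto
    have "coords (x \<oplus> y) i = coords x i \<oplus> coords y i"
      if x: "x \<in> carrier K" and y: "y \<in> carrier K" for x y
    proof -
      let ?a = "\<lambda>i\<in>{..<n}. coords x i \<oplus> coords y i"
      have "?comb ?a = (\<Oplus>i\<in>{..<n}. coords x i \<otimes> b i \<oplus> coords y i \<otimes> b i)"
        by (rule finsum_cong') (use x y bK coordsK in \<open>auto simp: l_distr\<close>)
      also have "\<dots> = ?comb (coords x) \<oplus> ?comb (coords y)"
        by (rule finsum_addf) (use x y bK coordsK in auto)
      finally have comb: "?comb ?a = x \<oplus> y"
        using x y coords(2) by simp
      have "?a \<in> {..<n} \<rightarrow>\<^sub>E F"
        unfolding restrict_PiE_iff using x y coords_F F_closed(7) by simp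
      from coords_eqI[OF a_closed[OF x y] this comb i] have "coords (x \<oplus> y) i = ?a i" .
      then show ?thesis using i by simp
    qed
    moreover have "coords (r \<otimes> x) i = r \<otimes> coords x i"
      if r: "r \<in> F" and x: "x \<in> carrier K" for r x
    proof -
      have rK: "r \<in> carrier K" using r F_subset by blast
      let ?a = "\<lambda>i\<in>{..<n}. r \<otimes> coords x i"
      have "?comb ?a = (\<Oplus>i\<in>{..<n}. r \<otimes> (coords x i \<otimes> b i))"
        by (rule finsum_cong') (use x rK bK coordsK in \<open>auto simp: m_assoc\<close>)
      also have "\<dots> = r \<otimes> ?comb (coords x)"
        by (rule finsum_rdistr[symmetric]) (use x rK bK coordsK in auto)
      finally have comb: "?comb ?a = r \<otimes> x"
        using x coords(2) by simp
      have "?a \<in> {..<n} \<rightarrow>\<^sub>E F"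
        unfolding restrict_PiE_iff using x r coords_F F_closed(6) by simp
      from coords_eqI[OF m_closed[OF rK x] this comb i] have "coords (r \<otimes> x) i = ?a i" .
      then show ?thesis using i by simp
    qed
    ultimately show "(\<lambda>x\<in>carrier K. coords x i) \<in> carrier (dual_module R V)"
      using i coords_F F_subset unfolding dual_module_def by (auto simp: subset_iff)
  next
    fix x assume "x \<in> carrier V"
    then show "(\<Oplus>\<^bsub>V\<^esub>i\<in>{..<n}. (\<lambda>x\<in>carrier K. coords x i) x \<odot>\<^bsub>V\<^esub> b i) = x"
      using coords(2) by simp
  qed
  then show ?thesis by blast
qed

text \<open>A linear map is determined by its values on a basis.\<close>

lemma card_End_le: "finite (carrier E)" "card (carrier E) \<le> (q ^ n) ^ n"
proof -
  obtain b c where "dual_basis R V n b c"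
    using dual_basis_exists by blast
  then interpret B: dual_basis R V n b c .
  let ?val = "\<lambda>\<phi>. \<lambda>i\<in>{..<n}. \<phi> (b i)"
  have into: "?val ` carrier E \<subseteq> {..<n} \<rightarrow>\<^sub>E carrier K"
  proof (intro image_subsetI)
    fix \<phi> assume "\<phi> \<in> carrier E"
    then show "?val \<phi> \<in> {..<n} \<rightarrow>\<^sub>E carrier K"
      using B.b_closed End_apply_closed[of \<phi> R V] by (simp add: restrict_PiE_iff)
  qed
  have "inj_on ?val (carrier E)"
  proof (rule inj_onI)
    fix \<phi> \<psi> assume \<phi>: "\<phi> \<in> carrier E" and \<psi>: "\<psi> \<in> carrier E" and eq: "?val \<phi> = ?val \<psi>"
    show "\<phi> = \<psi>"
    proof (rule End_eqI[where R = R and V = V, OF \<phi> \<psi>])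
      fix x assume x: "x \<in> carrier V"
      have expand: "\<chi> x = (\<Oplus>\<^bsub>V\<^esub>i\<in>{..<n}. c i x \<odot>\<^bsub>V\<^esub> \<chi> (b i))" if \<chi>: "\<chi> \<in> carrier E" for \<chi>
      proof -
        have cF: "c i x \<in> carrier R" if "i < n" for i
          using dual_linear(3)[OF B.c_closed[OF that] x] .
        have "\<chi> x = \<chi> (\<Oplus>\<^bsub>V\<^esub>i\<in>{..<n}. c i x \<odot>\<^bsub>V\<^esub> b i)"
          using B.expansion[OF x] by simp
        also have "\<dots> = (\<Oplus>\<^bsub>V\<^esub>i\<in>{..<n}. \<chi> (c i x \<odot>\<^bsub>V\<^esub> b i))"
          by (rule finsum_additive[OF V.abelian_group_axioms V.abelian_group_axioms])
            (use End_apply_closed[OF \<chi>] End_linear(1)[OF \<chi>] cF B.b_closed V.smult_closed in auto)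
        also have "\<dots> = (\<Oplus>\<^bsub>V\<^esub>i\<in>{..<n}. c i x \<odot>\<^bsub>V\<^esub> \<chi> (b i))"
          by (rule V.M.finsum_cong')
            (use End_apply_closed[OF \<chi>] End_linear(2)[OF \<chi>] cF B.b_closed V.smult_closed in auto)
        finally show ?thesis .
      qed
      have "\<phi> (b i) = \<psi> (b i)" if "i < n" for i
        using fun_cong[OF eq, of i] that by simp
      then have "(\<Oplus>\<^bsub>V\<^esub>i\<in>{..<n}. c i x \<odot>\<^bsub>V\<^esub> \<phi> (b i)) = (\<Oplus>\<^bsub>V\<^esub>i\<in>{..<n}. c i x \<odot>\<^bsub>V\<^esub> \<psi> (b i))"
        by (intro V.M.finsum_cong')
          (use End_apply_closed[OF \<psi>] dual_linear(3)[OF B.c_closed _] x B.b_closed V.smult_closed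
            in auto)
      then show "\<phi> x = \<psi> x"
        using expand[OF \<phi>] expand[OF \<psi>] by simp
    qed
  qed
  moreover have "finite ({..<n} \<rightarrow>\<^sub>E carrier K)"
    using finite_K by (simp add: finite_PiE)
  moreover have "card ({..<n} \<rightarrow>\<^sub>E carrier K) = (q ^ n) ^ n"
    by (simp add: card_PiE card_K)
  ultimately show "finite (carrier E)" "card (carrier E) \<le> (q ^ n) ^ n"
    using into inj_on_finite card_inj_on_le by metis+
qed


section \<open>Linearized polynomials\<close>

definition poly_fun :: "(nat \<Rightarrow> 'a) \<Rightarrow> 'a \<Rightarrow> 'a"
  where "poly_fun f = (\<lambda>x\<in>carrier K. ev x f)"

abbreviation "linearized a \<equiv> (\<Oplus>\<^bsub>P\<^esub>i\<in>{..<n}. monom P (a i) (q ^ i))"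

lemma poly_fun_eq_iff: "poly_fun f = poly_fun g \<longleftrightarrow> (\<forall>x\<in>carrier K. ev x f = ev x g)"
  by (auto simp: poly_fun_def fun_eq_iff restrict_def)

lemma card_K_gt_1: "n \<ge> 1 \<Longrightarrow> 1 < q ^ n"
  using one_less_power[OF q_gt_1, of n] by simp

text \<open>Division by \<open>x\<^bsup>q^n\<^esup> - x\<close>, which vanishes on \<open>K\<close>, leaves a remainder with the same
  values and degree below \<open>q\<^sup>n = |K|\<close>.\<close>

lemma frobenius_ideal_eq:
  assumes "n \<ge> 1"
  shows "frobenius_ideal K q n = {f \<in> carrier P. \<forall>x\<in>carrier K. ev x f = \<zero>}" (is "_ = ?N")
proof -
  define g where "g = monom P \<one> (q ^ n) \<ominus>\<^bsub>P\<^esub> monom P \<one> 1"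
  have g: "g \<in> carrier P" by (simp add: g_def)
  have ev_g: "ev x g = \<zero>" if "x \<in> carrier K" for x
    using that by (simp add: g_def Poly.evalRR_simps K_pow)
  have le: "frobenius_ideal K q n \<subseteq> ?N"
    unfolding frobenius_ideal_def cgenideal_def g_def[symmetric]
    using g ev_g by (auto simp: Poly.evalRR_mult Poly.carrier_evalRR)
  have coeff_g: "coeff P g k = (if k = q ^ n then \<one> else if k = 1 then \<ominus> \<one> else \<zero>)" for k
    using card_K_gt_1[OF assms] by (auto simp: g_def Poly.coeff_minus a_minus_def)
  have deg_g: "deg K g = q ^ n"
  proof (rule le_antisym)
    show "deg K g \<le> q ^ n"
      by (rule Poly.deg_aboveI[OF _ g]) (use card_K_gt_1[OF assms] coeff_g in simp)
    show "q ^ n \<le> deg K g"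
      by (rule Poly.deg_belowI[OF _ g]) (simp only: coeff_g, simp)
  qed
  have ge: "?N \<subseteq> frobenius_ideal K q n"
  proof
    fix f assume "f \<in> ?N"
    then have f: "f \<in> carrier P" and ev_f: "\<And>x. x \<in> carrier K \<Longrightarrow> ev x f = \<zero>" by auto
    have "g \<noteq> \<zero>\<^bsub>P\<^esub>"
      using deg_g card_K_gt_1[OF assms] by (metis Poly.deg_zero not_one_less_zero)
    then obtain h r k where h: "h \<in> carrier P" and r: "r \<in> carrier P"
      and div: "coeff P g (deg K g) [^] (k::nat) \<odot>\<^bsub>P\<^esub> f = g \<otimes>\<^bsub>P\<^esub> h \<oplus>\<^bsub>P\<^esub> r"
      and deg_r: "r = \<zero>\<^bsub>P\<^esub> \<or> deg K r < deg K g"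
      using Poly.long_div_theorem[OF g f] by blast
    have "coeff P g (deg K g) = \<one>"
      unfolding coeff_g deg_g by simp
    then have f_eq: "f = g \<otimes>\<^bsub>P\<^esub> h \<oplus>\<^bsub>P\<^esub> r"
      using div f by (simp only: nat_pow_one Poly.UP_smult_one)
    have "ev x r = \<zero>" if x: "x \<in> carrier K" for x
    proof -
      have "ev x f = ev x g \<otimes> ev x h \<oplus> ev x r"
        unfolding f_eq using x g h r by (simp add: Poly.evalRR_add Poly.evalRR_mult)
      then show ?thesis
        using ev_f[OF x] ev_g[OF x] x h r by (simp add: Poly.carrier_evalRR)
    qed
    moreover have "coeff P r k = \<zero>" if "card (carrier K) \<le> k" for k
      using deg_r that deg_g card_K r by (auto intro: Poly.deg_aboveD)
    ultimately have "r = \<zero>\<^bsub>P\<^esub>"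
      using Poly.few_roots_imp_zero[OF finite_K r subset_refl] by blast
    then have "f = h \<otimes>\<^bsub>P\<^esub> g"
      using f_eq g h by (simp add: Poly.P.m_comm)
    then show "f \<in> frobenius_ideal K q n"
      unfolding frobenius_ideal_def cgenideal_def g_def[symmetric] using h by blast
  qed
  from le ge show ?thesis by (rule equalityI)
qed

lemma up_compose:
  assumes f: "f \<in> carrier P" and g: "g \<in> carrier P"
  shows "up_compose K f g \<in> carrier P"
    and "x \<in> carrier K \<Longrightarrow> ev x (up_compose K f g) = ev (ev x g) f"
proof -
  let ?t = "\<lambda>i. monom P (coeff P f i) 0 \<otimes>\<^bsub>P\<^esub> g [^]\<^bsub>P\<^esub> i"
  have eq: "up_compose K f g = (\<Oplus>\<^bsub>P\<^esub>i\<in>{..deg K f}. ?t i)"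
    unfolding up_compose_def by (rule Poly.eval_on_carrier[OF f])
  have t: "?t \<in> {..deg K f} \<rightarrow> carrier P"
    using f g by simp
  then show "up_compose K f g \<in> carrier P"
    unfolding eq by (rule Poly.P.finsum_closed)
  assume x: "x \<in> carrier K"
  have pow: "ev x (g [^]\<^bsub>P\<^esub> i) = ev x g [^] i" for i :: nat
    by (induction i) (use x g Poly.evalRR_one[OF x] Poly.evalRR_mult[OF _ g x] in \<open>simp_all add: id_def\<close>)
  have "ev x (up_compose K f g) = (\<Oplus>i\<in>{..deg K f}. ev x (?t i))"
    unfolding eq by (rule ev_finsum[OF t x])
  also have "\<dots> = (\<Oplus>i\<in>{..deg K f}. coeff P f i \<otimes> ev x g [^] i)"
    by (rule finsum_cong')
      (use x f g in \<open>simp_all add: Poly.evalRR_mult Poly.evalRR_monom pow Poly.carrier_evalRR\<close>)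
  also have "\<dots> = ev (ev x g) f"
    using Poly.eval_on_carrier[OF f, of K id "ev x g"] by simp
  finally show "ev x (up_compose K f g) = ev (ev x g) f" .
qed

lemma linearized_closed: "a \<in> {..<n} \<rightarrow> carrier K \<Longrightarrow> linearized a \<in> carrier P"
  by (rule Poly.P.finsum_closed) (auto simp: Pi_iff)

lemma ev_linearized:
  assumes a: "a \<in> {..<n} \<rightarrow> carrier K" and x: "x \<in> carrier K"
  shows "ev x (linearized a) = (\<Oplus>i\<in>{..<n}. a i \<otimes> x [^] (q ^ i))"
proof -
  have "ev x (linearized a) = (\<Oplus>i\<in>{..<n}. ev x (monom P (a i) (q ^ i)))"
    by (rule ev_finsum) (use a x in \<open>auto simp: Pi_iff\<close>)
  also have "\<dots> = (\<Oplus>i\<in>{..<n}. a i \<otimes> x [^] (q ^ i))"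
    by (rule finsum_cong') (use a x in \<open>auto simp: Poly.evalRR_monom Pi_iff\<close>)
  finally show ?thesis .
qed

lemma poly_fun_linearized_End:
  assumes a: "a \<in> {..<n} \<rightarrow> carrier K"
  shows "poly_fun (linearized a) \<in> carrier E"
proof -
  have ai: "a i \<in> carrier K" if "i < n" for i using a that by auto
  have add: "ev (x \<oplus> y) (linearized a) = ev x (linearized a) \<oplus> ev y (linearized a)"
    if x: "x \<in> carrier K" and y: "y \<in> carrier K" for x y
  proof -
    have "ev (x \<oplus> y) (linearized a) =
        (\<Oplus>i\<in>{..<n}. a i \<otimes> x [^] (q ^ i) \<oplus> a i \<otimes> y [^] (q ^ i))"
      unfolding ev_linearized[OF a a_closed[OF x y]]
      by (rule finsum_cong') (use x y ai in \<open>auto simp: frobenius_power_add r_distr\<close>)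
    also have "\<dots> = ev x (linearized a) \<oplus> ev y (linearized a)"
      unfolding ev_linearized[OF a x] ev_linearized[OF a y]
      by (rule finsum_addf) (use x y ai in auto)
    finally show ?thesis .
  qed
  have smult: "ev (r \<otimes> x) (linearized a) = r \<otimes> ev x (linearized a)"
    if r: "r \<in> F" and x: "x \<in> carrier K" for r x
  proof -
    have rK: "r \<in> carrier K" using r F_subset by blast
    have "ev (r \<otimes> x) (linearized a) = (\<Oplus>i\<in>{..<n}. r \<otimes> (a i \<otimes> x [^] (q ^ i)))"
      unfolding ev_linearized[OF a m_closed[OF rK x]]
      by (rule finsum_cong')
        (use x rK ai in \<open>auto simp: nat_pow_distrib frobenius_power_F[OF r] m_lcomm\<close>)
    also have "\<dots> = r \<otimes> ev x (linearized a)"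
      unfolding ev_linearized[OF a x]
      by (rule finsum_rdistr[symmetric]) (use x rK ai in auto)
    finally show ?thesis .
  qed
  show ?thesis
    unfolding End_carrier poly_fun_def
    using add smult F_subset Poly.carrier_evalRR[OF _ linearized_closed[OF a]]
    by (auto simp: subset_iff)
qed

text \<open>As \<open>q > 1\<close>, the exponents \<open>q\<^sup>i\<close> are distinct and below \<open>q\<^sup>n\<close>, so the coefficients can be read
  off and the degree is small enough for the root count.\<close>

lemma linearized_coeff:
  assumes a: "a \<in> {..<n} \<rightarrow> carrier K"
  shows "j < n \<Longrightarrow> coeff P (linearized a) (q ^ j) = a j"
    and "q ^ n \<le> k \<Longrightarrow> coeff P (linearized a) k = \<zero>"
proof -
  have ai: "a i \<in> carrier K" if "i < n" for i using a that by auto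
  have coeff: "coeff P (linearized a) k = (\<Oplus>i\<in>{..<n}. if q ^ i = k then a i else \<zero>)" for k
  proof -
    have "coeff P (linearized a) k = (\<Oplus>i\<in>{..<n}. coeff P (monom P (a i) (q ^ i)) k)"
      by (rule Poly.coeff_finsum) (use ai in auto)
    also have "\<dots> = (\<Oplus>i\<in>{..<n}. if q ^ i = k then a i else \<zero>)"
      by (rule finsum_cong') (use ai in auto)
    finally show ?thesis .
  qed
  show "coeff P (linearized a) (q ^ j) = a j" if j: "j < n"
  proof -
    have "coeff P (linearized a) (q ^ j) = (\<Oplus>i\<in>{..<n}. if j = i then a i else \<zero>)"
      unfolding coeff by (rule finsum_cong') (use q_gt_1 ai in auto)
    also have "\<dots> = a j"
      by (rule finsum_singleton) (use j ai in auto)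
    finally show ?thesis .
  qed
  show "coeff P (linearized a) k = \<zero>" if "q ^ n \<le> k"
  proof -
    have "q ^ i \<noteq> k" if "i < n" for i
      using that \<open>q ^ n \<le> k\<close> power_strict_increasing[OF that q_gt_1] by linarith
    then show ?thesis
      unfolding coeff by (intro add.finprod_one_eqI) auto
  qed
qed

lemma poly_fun_linearized_inj:
  "inj_on (\<lambda>a. poly_fun (linearized a)) ({..<n} \<rightarrow>\<^sub>E carrier K)"
proof (rule inj_onI)
  fix a a' assume a: "a \<in> {..<n} \<rightarrow>\<^sub>E carrier K" and a': "a' \<in> {..<n} \<rightarrow>\<^sub>E carrier K"
    and eq: "poly_fun (linearized a) = poly_fun (linearized a')"
  have Pi: "a \<in> {..<n} \<rightarrow> carrier K" "a' \<in> {..<n} \<rightarrow> carrier K" using a a' by auto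
  note closed = linearized_closed[OF Pi(1)] linearized_closed[OF Pi(2)]
  have "linearized a \<ominus>\<^bsub>P\<^esub> linearized a' = \<zero>\<^bsub>P\<^esub>"
  proof (rule Poly.few_roots_imp_zero[OF finite_K _ subset_refl])
    show "linearized a \<ominus>\<^bsub>P\<^esub> linearized a' \<in> carrier P" using closed by simp
    show "ev x (linearized a \<ominus>\<^bsub>P\<^esub> linearized a') = \<zero>" if "x \<in> carrier K" for x
      using eq closed that by (simp add: poly_fun_eq_iff Poly.evalRR_simps)
    show "coeff P (linearized a \<ominus>\<^bsub>P\<^esub> linearized a') k = \<zero>" if "card (carrier K) \<le> k" for k
      using that closed linearized_coeff(2)[OF Pi(1)] linearized_coeff(2)[OF Pi(2)]
      by (simp add: card_K Poly.coeff_minus)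
  qed
  then have "linearized a = linearized a'" using closed by simp
  then have "a i = a' i" if "i < n" for i
    using linearized_coeff(1)[OF Pi(1) that] linearized_coeff(1)[OF Pi(2) that] by simp
  then show "a = a'"
    using a a' by (intro PiE_ext[of a "{..<n}" "\<lambda>_. carrier K" a']) auto
qed

text \<open>The injection of the \<open>(q\<^sup>n)\<^sup>n\<close> coefficient families into a set of at most that size is
  onto.\<close>

lemma linearized_surj:
  assumes "\<phi> \<in> carrier E"
  obtains a where "a \<in> {..<n} \<rightarrow> carrier K" "poly_fun (linearized a) = \<phi>"
proof -
  let ?h = "\<lambda>a. poly_fun (linearized a)"
  have image: "?h ` ({..<n} \<rightarrow>\<^sub>E carrier K) = carrier E"
  proof (rule card_seteq)
    show "?h ` ({..<n} \<rightarrow>\<^sub>E carrier K) \<subseteq> carrier E"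
      using poly_fun_linearized_End by (auto simp: PiE_iff)
    have "card (?h ` ({..<n} \<rightarrow>\<^sub>E carrier K)) = (q ^ n) ^ n"
      using card_image[OF poly_fun_linearized_inj] by (simp add: card_PiE card_K)
    then show "card (carrier E) \<le> card (?h ` ({..<n} \<rightarrow>\<^sub>E carrier K))"
      using card_End_le(2) by simp
  qed (rule card_End_le(1))
  obtain a where a: "\<phi> = ?h a" "a \<in> {..<n} \<rightarrow>\<^sub>E carrier K"
    by (rule imageE[OF assms[folded image]])
  show ?thesis
    by (rule that[of a]) (use a in auto)
qed

lemma poly_fun_hom:
  assumes f: "f \<in> carrier P" and g: "g \<in> carrier P"
  shows "poly_fun (f \<oplus>\<^bsub>P\<^esub> g) = poly_fun f \<oplus>\<^bsub>E\<^esub> poly_fun g"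
    and "poly_fun (up_compose K f g) = poly_fun f \<otimes>\<^bsub>E\<^esub> poly_fun g"
    and "r \<in> F \<Longrightarrow> poly_fun (r \<odot>\<^bsub>P\<^esub> f) = r \<odot>\<^bsub>E\<^esub> poly_fun f"
proof -
  show "poly_fun (f \<oplus>\<^bsub>P\<^esub> g) = poly_fun f \<oplus>\<^bsub>E\<^esub> poly_fun g"
    unfolding poly_fun_def End_algebra_def
    by (auto simp: Poly.evalRR_add[OF f g] intro!: restrict_ext)
  show "poly_fun (up_compose K f g) = poly_fun f \<otimes>\<^bsub>E\<^esub> poly_fun g"
    unfolding poly_fun_def End_algebra_def
    by (auto simp: up_compose(2)[OF f g] Poly.carrier_evalRR[OF _ g] intro!: restrict_ext)
  show "poly_fun (r \<odot>\<^bsub>P\<^esub> f) = r \<odot>\<^bsub>E\<^esub> poly_fun f" if "r \<in> F"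
  proof -
    have rK: "r \<in> carrier K" using that F_subset by blast
    have "ev x (r \<odot>\<^bsub>P\<^esub> f) = r \<otimes> ev x f" if x: "x \<in> carrier K" for x
      using Poly.monom_mult_is_smult[OF rK f] Poly.evalRR_mult[OF _ f x, of "monom P r 0"]
        Poly.evalRR_monom[OF rK x, of 0] rK by simp
    then show ?thesis
      unfolding poly_fun_def End_algebra_def by (auto intro!: restrict_ext)
  qed
qed

lemma linearized_presentation:
  assumes "n \<ge> 1"
  shows "algebra_presentation R E (frobenius_ideal K q n) P poly_fun (up_compose K)"
proof -
  have ideal: "ideal (frobenius_ideal K q n) P"
    unfolding frobenius_ideal_def by (rule Poly.P.cgenideal_ideal) simp
  have N: "abelian_subgroup (frobenius_ideal K q n) P"
    by (rule abelian_subgroupI3[OF ideal.axioms(1)[OF ideal] Poly.P.abelian_group_axioms])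
  have zero: "ev x \<zero>\<^bsub>P\<^esub> = \<zero>" if "x \<in> carrier K" for x
    using Poly.evalRR_monom[of \<zero> x 0] that by simp
  show ?thesis
  proof (rule algebra_presentation.intro[OF V.End_assoc_algebra N algebra_presentation_axioms.intro])
    fix f assume f: "f \<in> carrier P"
    have "h \<in> frobenius_ideal K q n +>\<^bsub>P\<^esub> f \<longleftrightarrow> poly_fun h = poly_fun f" if h: "h \<in> carrier P" for h
    proof -
      have "h \<in> frobenius_ideal K q n +>\<^bsub>P\<^esub> f \<longleftrightarrow> (\<forall>x\<in>carrier K. ev x (h \<ominus>\<^bsub>P\<^esub> f) = \<zero>)"
        using abelian_subgroup.a_rcos_module[OF N f h] f h
        by (simp add: frobenius_ideal_eq[OF assms] a_minus_def)
      then show ?thesis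
        using f h by (simp add: poly_fun_eq_iff Poly.evalRR_sub Poly.carrier_evalRR)
    qed
    moreover have "frobenius_ideal K q n +>\<^bsub>P\<^esub> f \<subseteq> carrier P"
      using Poly.P.a_r_coset_subset_G[OF _ f] frobenius_ideal_eq[OF assms] by auto
    ultimately show "frobenius_ideal K q n +>\<^bsub>P\<^esub> f = {h \<in> carrier P. poly_fun h = poly_fun f}"
      by blast
  next
    fix \<phi> assume "\<phi> \<in> carrier E"
    then show "\<exists>f\<in>carrier P. poly_fun f = \<phi>"
      by (rule linearized_surj) (use linearized_closed in auto)
  next
    show "poly_fun \<zero>\<^bsub>P\<^esub> = \<zero>\<^bsub>E\<^esub>"
      unfolding poly_fun_def End_algebra_def by (auto simp: zero intro!: restrict_ext)
  next
    fix r f assume "r \<in> carrier R" "f \<in> carrier P"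
    then show "r \<odot>\<^bsub>P\<^esub> f \<in> carrier P \<and> poly_fun (r \<odot>\<^bsub>P\<^esub> f) = r \<odot>\<^bsub>E\<^esub> poly_fun f"
      using F_subset poly_fun_hom(3)[of f f r] by auto
  qed (simp_all add: poly_fun_hom up_compose)
qed

lemma linearized_algebra_eq:
  assumes "n \<ge> 1"
  shows "linearized_algebra K q n =
    algebra_presentation.coset_algebra E (frobenius_ideal K q n) P poly_fun (up_compose K)"
proof -
  note L = linearized_presentation[OF assms]
  note L_coset = algebra_presentation.coset_eq_fibre[OF L]
  let ?I = "frobenius_ideal K q n"
  have carrier: "{?I +>\<^bsub>P\<^esub> linearized a | a. a \<in> {..<n} \<rightarrow> carrier K} =
      {?I +>\<^bsub>P\<^esub> f | f. f \<in> carrier P \<and> poly_fun f \<in> carrier E}" (is "?A = ?B")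
  proof
    show "?A \<subseteq> ?B"
    proof
      fix X assume "X \<in> ?A"
      then obtain a where a: "X = ?I +>\<^bsub>P\<^esub> linearized a" "a \<in> {..<n} \<rightarrow> carrier K"
        by auto
      then show "X \<in> ?B"
        using linearized_closed[OF a(2)] poly_fun_linearized_End[OF a(2)] by auto
    qed
    show "?B \<subseteq> ?A"
    proof
      fix X assume "X \<in> ?B"
      then obtain f where f: "X = ?I +>\<^bsub>P\<^esub> f" "f \<in> carrier P" "poly_fun f \<in> carrier E"
        by auto
      obtain a where a: "a \<in> {..<n} \<rightarrow> carrier K" "poly_fun (linearized a) = poly_fun f"
        by (rule linearized_surj[OF f(3)])
      have "X = ?I +>\<^bsub>P\<^esub> linearized a"
        using f a L_coset[OF f(2,3)] L_coset[OF linearized_closed[OF a(1)]] by simp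
      then show "X \<in> ?A" using a(1) by auto
    qed
  qed
  have id: "poly_fun (monom P \<one> 1) = \<one>\<^bsub>E\<^esub>"
    unfolding poly_fun_def End_algebra_def
    by (auto simp: Poly.evalRR_monom intro!: restrict_ext)
  have "\<one>\<^bsub>E\<^esub> \<in> carrier E"
    by (rule V.End_closed)
  then have one: "?I +>\<^bsub>P\<^esub> monom P \<one> 1 = algebra_presentation.fibre P poly_fun \<one>\<^bsub>E\<^esub>"
    using L_coset[of "monom P \<one> 1"] id by simp
  show ?thesis
    unfolding linearized_algebra_def Let_def algebra_presentation.coset_algebra_def[OF L] carrier one
    ..
qed

end

theorem theorem3p1:
  fixes K :: "('a, 'b) ring_scheme" and F :: "'a set" and q n :: nat
  assumes "primepow q" and "n \<ge> 1"
    and "field K" and "card (carrier K) = q ^ n"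
    and "subfield F K" and "card F = q"
  shows "assoc_algebra (K\<lparr>carrier := F\<rparr>) (linearized_algebra K q n) \<and>
    assoc_algebra (K\<lparr>carrier := F\<rparr>) (composition_algebra (K\<lparr>carrier := F\<rparr>) (ring_as_module K)) \<and>
    algebra_iso (K\<lparr>carrier := F\<rparr>) (linearized_algebra K q n)
      (composition_algebra (K\<lparr>carrier := F\<rparr>) (ring_as_module K)) \<noteq> {}"
proof -
  let ?R = "K\<lparr>carrier := F\<rparr>" and ?V = "ring_as_module K"
  have ext: "finite_extension K F q n"
    using assms primepow_gt_Suc_0[of q]
    by (simp add: finite_extension_def finite_extension_axioms_def)
  note pres = finite_extension.linearized_presentation[OF ext assms(2)]
  note lin_eq = finite_extension.linearized_algebra_eq[OF ext assms(2)]
  obtain b c where dual: "dual_basis ?R ?V n b c"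
    using finite_extension.dual_basis_exists[OF ext] by blast
  have L: "assoc_algebra ?R (linearized_algebra K q n)"
    unfolding lin_eq by (rule algebra_presentation.coset_algebra_assoc[OF pres])
  have C: "assoc_algebra ?R (composition_algebra ?R ?V)"
    by (rule dual_basis.composition_algebra_assoc[OF dual])
  obtain h where h: "h \<in> algebra_iso ?R (End_algebra ?R ?V) (linearized_algebra K q n)"
    unfolding lin_eq using algebra_presentation.fibre_iso[OF pres] by blast
  obtain k where k: "k \<in> algebra_iso ?R (End_algebra ?R ?V) (composition_algebra ?R ?V)"
    using dual_basis.composition_algebra_iso[OF dual] by blast
  have "assoc_algebra ?R (End_algebra ?R ?V)"
    by (rule module.End_assoc_algebra[OF finite_extension.V_module[OF ext]])
  from algebra_iso_comp_inv[OF this h k] show ?thesis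
    using L C by auto
qed

end
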